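(* The conjugation map $\widehat{\mathcal O}_\theta\to\mathbb R$, $\hat x\mapsto\hat x'$, is an isomorphism of fields which is a homeomorphism, where $\widehat{\mathcal O}_\theta$ carries the inframetric topology.
   Context: $\theta>1$ is a real quadratic unit with $N(\theta)=-1$, so $\theta^2=a\theta+1$ with an integer $a\ge1$; $K=\mathbb Q(\theta)\subset\mathbb R$, $\mathcal O_K$ its ring of integers, $\alpha'$ the Galois conjugate of $\alpha\in K$. A greedy polynomial is a finite sum $\sum_{i=m}^M b_i\theta^i$ with $b_i\in\{0,\dots,a\}$ such that $b_i=a$ implies $b_{i-1}=0$; every nonzero $\alpha\in\mathcal O_K$ is uniquely $\pm$ such a sum with $b_m\ne0$, and $|\alpha|_\theta:=\theta^{-m}$, $|0|_\theta=0$. $\widehat{\mathcal O}_\theta=\mathcal R_\theta/\mathcal M_\theta$, where $\mathcal R_\theta$ is the ring (componentwise operations) of sequences in $\mathcal O_K$ Cauchy for $|\cdot|_\theta$ and $\mathcal M_\theta$ the ideal of those with $|f_n|_\theta\to0$. For any Cauchy sequence $(x_i)$ the real sequence $(x_i')$ converges, and its limit depends only on the class $\hat x$; denote it $\hat x'$. For $\hat h\in\widehat{\mathcal O}_\theta$ put $|\hat h|_\theta:=\max_{(h_i)\in\hat h}\limsup_i|h_i|_\theta$. The inframetric topology on $\widehat{\mathcal O}_\theta$ is the unique topology in which, for each $\hat f$, the sets $\{\hat g:|\hat f-\hat g|_\theta<\varepsilon\}$, $\varepsilon>0$, form a base of the neighbourhood filter of $\hat f$.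
   Formalization: The formal theorem assumes O_K = Z[θ]; without it some elements of O_K have no greedy expansion, so |·|_θ is undefined on O_K (e.g. (1+√5)/2 for θ = 2+√5). *)

theory Defs
  imports "HOL-Analysis.Analysis" "HOL-Algebra.Algebraic_Closure_Type"
begin

text \<open>
  Throughout, \<open>\<theta> > 1\<close> is real with \<open>\<theta>\<^sup>2 = a \<theta> + 1\<close> for an integer \<open>a \<ge> 1\<close>. Then \<open>\<theta>\<close> is a
  quadratic irrational (\<open>a\<^sup>2 + 4\<close> is not a square), so \<open>\<rat>(\<theta>) = \<rat> + \<rat> \<theta>\<close>, and its Galois
  conjugate is \<open>- 1 / \<theta>\<close>.
\<close>

definition quad_field :: "real \<Rightarrow> real set" where
  "quad_field \<theta> = {of_rat p + of_rat q * \<theta> | p q. True}"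

definition ring_of_integers :: "real \<Rightarrow> real set" where
  "ring_of_integers \<theta> = {\<alpha> \<in> quad_field \<theta>. algebraic_int \<alpha>}"

definition int_adjoin :: "real \<Rightarrow> real set" where
  "int_adjoin \<theta> = {of_int m + of_int n * \<theta> | m n. True}"

definition galois_conj :: "real \<Rightarrow> real \<Rightarrow> real" where
  "galois_conj \<theta> \<alpha> =
     (THE \<beta>. \<exists>p q. \<alpha> = of_rat p + of_rat q * \<theta> \<and> \<beta> = of_rat p + of_rat q * (- 1 / \<theta>))"

text \<open>
  A greedy polynomial is given by its digits \<open>b i\<close>, indexed by all integers and zero outside a
  finite set.
\<close>

definition greedy_digits :: "int \<Rightarrow> (int \<Rightarrow> int) \<Rightarrow> bool" where
  "greedy_digits a b \<longleftrightarrow>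
     finite {i. b i \<noteq> 0} \<and> (\<forall>i. b i \<in> {0..a}) \<and> (\<forall>i. b i = a \<longrightarrow> b (i - 1) = 0)"

definition greedy_value :: "real \<Rightarrow> (int \<Rightarrow> int) \<Rightarrow> real" where
  "greedy_value \<theta> b = (\<Sum>i | b i \<noteq> 0. of_int (b i) * \<theta> powi i)"

definition greedy_expansion :: "int \<Rightarrow> real \<Rightarrow> (int \<Rightarrow> int) \<Rightarrow> real \<Rightarrow> bool" where
  "greedy_expansion a \<theta> b \<alpha> \<longleftrightarrow>
     greedy_digits a b \<and> (\<alpha> = greedy_value \<theta> b \<or> \<alpha> = - greedy_value \<theta> b)"

definition theta_abs :: "int \<Rightarrow> real \<Rightarrow> real \<Rightarrow> real" where
  "theta_abs a \<theta> \<alpha> =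
     (if \<alpha> = 0 then 0
      else \<theta> powi (- (THE m. \<exists>b. greedy_expansion a \<theta> b \<alpha> \<and> b m \<noteq> 0 \<and> (\<forall>i<m. b i = 0))))"

text \<open>
  The greedy sums all lie in \<open>\<int>[\<theta>]\<close>. Hence if every nonzero algebraic integer of \<open>\<rat>(\<theta>)\<close> has a
  greedy expansion up to sign, which is what makes \<^const>\<open>theta_abs\<close> meaningful on the ring of
  integers, then that ring equals \<open>\<int>[\<theta>]\<close>. This is a genuine condition: it fails for
  \<open>\<theta> = 2 + sqrt 5\<close>, \<open>a = 4\<close>.
\<close>

lemma greedy_value_in_int_adjoin:
  assumes "\<theta> > 1" "\<theta>\<^sup>2 = of_int a * \<theta> + 1"
  shows "greedy_value \<theta> b \<in> int_adjoin \<theta>"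
proof -
  have mult: "x * \<theta> \<in> int_adjoin \<theta>" if "x \<in> int_adjoin \<theta>" for x
  proof -
    from that obtain m n where x: "x = of_int m + of_int n * \<theta>"
      by (auto simp: int_adjoin_def)
    have "x * \<theta> = of_int m * \<theta> + of_int n * \<theta>\<^sup>2"
      by (simp add: x algebra_simps power2_eq_square)
    also have "\<dots> = of_int n + of_int (m + n * a) * \<theta>"
      by (simp add: assms(2) algebra_simps)
    finally show ?thesis unfolding int_adjoin_def by blast
  qed
  have inv: "inverse \<theta> = \<theta> - of_int a"
  proof -
    have "\<theta> * (\<theta> - of_int a) = 1"
      using assms(2) by (simp add: algebra_simps power2_eq_square)
    thus ?thesis by (rule inverse_unique)
  qed
  have divide: "x * inverse \<theta> \<in> int_adjoin \<theta>" if "x \<in> int_adjoin \<theta>" for x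
  proof -
    from that obtain m n where x: "x = of_int m + of_int n * \<theta>"
      by (auto simp: int_adjoin_def)
    have "x * inverse \<theta> = of_int m * inverse \<theta> + of_int n"
      using assms(1) by (simp add: x algebra_simps)
    also have "\<dots> = of_int (n - m * a) + of_int m * \<theta>"
      by (simp add: inv algebra_simps)
    finally show ?thesis unfolding int_adjoin_def by blast
  qed
  have const: "of_int k \<in> int_adjoin \<theta>" for k
    unfolding int_adjoin_def by (rule CollectI, rule exI[of _ k], rule exI[of _ 0]) simp
  have pow: "of_int k * \<theta> ^ n \<in> int_adjoin \<theta>" for k n
  proof (induction n)
    case 0
    show ?case using const[of k] by simp
  next
    case (Suc n)
    from mult[OF Suc] show ?case by (simp add: mult_ac)
  qed
  have ipow: "of_int k * inverse \<theta> ^ n \<in> int_adjoin \<theta>" for k n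
  proof (induction n)
    case 0
    show ?case using const[of k] by simp
  next
    case (Suc n)
    from divide[OF Suc] show ?case by (simp add: mult_ac)
  qed
  have add: "x + y \<in> int_adjoin \<theta>" if "x \<in> int_adjoin \<theta>" "y \<in> int_adjoin \<theta>" for x y
  proof -
    from that obtain m n m' n' where "x = of_int m + of_int n * \<theta>" "y = of_int m' + of_int n' * \<theta>"
      by (auto simp: int_adjoin_def)
    hence "x + y = of_int (m + m') + of_int (n + n') * \<theta>"
      by (simp add: algebra_simps)
    thus ?thesis unfolding int_adjoin_def by blast
  qed
  have "(\<Sum>i\<in>I. of_int (b i) * \<theta> powi i) \<in> int_adjoin \<theta>" for I
  proof (induction I rule: infinite_finite_induct)
    case (insert i I)
    have "of_int (b i) * \<theta> powi i \<in> int_adjoin \<theta>"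
      unfolding power_int_def using pow ipow by simp
    with insert show ?case by (simp add: add)
  qed (use const[of 0] in simp_all)
  thus ?thesis by (simp add: greedy_value_def)
qed

lemma greedy_expansions_imp_ring_of_integers_eq:
  assumes "\<theta> > 1" "\<theta>\<^sup>2 = of_int a * \<theta> + 1"
    and "\<And>\<alpha>. \<alpha> \<in> ring_of_integers \<theta> \<Longrightarrow> \<alpha> \<noteq> 0 \<Longrightarrow> \<exists>b. greedy_expansion a \<theta> b \<alpha>"
  shows "ring_of_integers \<theta> = int_adjoin \<theta>"
proof (intro equalityI subsetI)
  have uminus: "- x \<in> int_adjoin \<theta>" if x: "x \<in> int_adjoin \<theta>" for x
  proof -
    from x obtain m n where "x = of_int m + of_int n * \<theta>"
      by (auto simp: int_adjoin_def)
    hence "- x = of_int (- m) + of_int (- n) * \<theta>" by simp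
    thus ?thesis unfolding int_adjoin_def by blast
  qed
  fix \<alpha> assume \<alpha>: "\<alpha> \<in> ring_of_integers \<theta>"
  show "\<alpha> \<in> int_adjoin \<theta>"
  proof (cases "\<alpha> = 0")
    case True
    have "(0::real) = of_int 0 + of_int 0 * \<theta>" by simp
    with True show ?thesis unfolding int_adjoin_def by blast
  next
    case False
    with assms(3)[OF \<alpha>] obtain b where "greedy_expansion a \<theta> b \<alpha>" by blast
    with greedy_value_in_int_adjoin[OF assms(1,2)] uminus show ?thesis
      by (auto simp: greedy_expansion_def)
  qed
next
  fix \<alpha> assume "\<alpha> \<in> int_adjoin \<theta>"
  then obtain m n where \<alpha>: "\<alpha> = of_int m + of_int n * \<theta>"
    by (auto simp: int_adjoin_def)
  define p :: "real poly" where
    "p = [:of_int (m\<^sup>2 + m * n * a - n\<^sup>2), of_int (- (2 * m + n * a)), 1:]"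
  have "poly p \<alpha> = of_int n ^ 2 * (\<theta>\<^sup>2 - of_int a * \<theta> - 1)"
    by (simp add: p_def \<alpha> algebra_simps power2_eq_square)
  hence "poly p \<alpha> = 0" using assms(2) by simp
  moreover have "Polynomial.coeff p i \<in> \<int>" for i
    by (auto simp: p_def coeff_pCons split: nat.splits)
  moreover have "Polynomial.lead_coeff p = 1" by (simp add: p_def)
  ultimately have "algebraic_int \<alpha>" by (intro algebraic_int.intros) auto
  moreover have "\<alpha> = of_rat (of_int m) + of_rat (of_int n) * \<theta>" by (simp add: \<alpha>)
  hence "\<alpha> \<in> quad_field \<theta>" unfolding quad_field_def by blast
  ultimately show "\<alpha> \<in> ring_of_integers \<theta>" by (simp add: ring_of_integers_def)
qed

definition theta_cauchy :: "int \<Rightarrow> real \<Rightarrow> (nat \<Rightarrow> real) \<Rightarrow> bool" where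
  "theta_cauchy a \<theta> f \<longleftrightarrow>
     (\<forall>\<epsilon>>0. \<exists>N. \<forall>m\<ge>N. \<forall>n\<ge>N. theta_abs a \<theta> (f m - f n) < \<epsilon>)"

definition cauchy_ring :: "int \<Rightarrow> real \<Rightarrow> (nat \<Rightarrow> real) ring" where
  "cauchy_ring a \<theta> = \<lparr>
     carrier = {f. range f \<subseteq> ring_of_integers \<theta> \<and> theta_cauchy a \<theta> f},
     monoid.mult = (\<lambda>f g i. f i * g i),
     monoid.one = (\<lambda>i. 1),
     ring.zero = (\<lambda>i. 0),
     ring.add = (\<lambda>f g i. f i + g i)\<rparr>"

definition null_ideal :: "int \<Rightarrow> real \<Rightarrow> (nat \<Rightarrow> real) set" where
  "null_ideal a \<theta> =
     {f \<in> carrier (cauchy_ring a \<theta>). (\<lambda>i. theta_abs a \<theta> (f i)) \<longlonglongrightarrow> 0}"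

text \<open>An element of the completion is a coset, that is, the set of the sequences representing it.\<close>

definition theta_completion :: "int \<Rightarrow> real \<Rightarrow> (nat \<Rightarrow> real) set ring" where
  "theta_completion a \<theta> = cauchy_ring a \<theta> Quot null_ideal a \<theta>"

definition completion_conj :: "real \<Rightarrow> (nat \<Rightarrow> real) set \<Rightarrow> real" where
  "completion_conj \<theta> F = (THE y. \<forall>x\<in>F. (\<lambda>i. galois_conj \<theta> (x i)) \<longlonglongrightarrow> y)"

text \<open>
  The maximum is taken with \<open>GREATEST\<close> because \<open>Max\<close> is restricted to finite sets; it lives in
  \<^typ>\<open>ereal\<close> because \<^const>\<open>limsup\<close> needs a complete lattice.
\<close>

definition completion_abs :: "int \<Rightarrow> real \<Rightarrow> (nat \<Rightarrow> real) set \<Rightarrow> ereal" where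
  "completion_abs a \<theta> H =
     (GREATEST v. \<exists>h\<in>H. v = limsup (\<lambda>i. ereal (theta_abs a \<theta> (h i))))"

definition inframetric_ball ::
    "int \<Rightarrow> real \<Rightarrow> (nat \<Rightarrow> real) set \<Rightarrow> real \<Rightarrow> (nat \<Rightarrow> real) set set" where
  "inframetric_ball a \<theta> F \<epsilon> =
     {G \<in> carrier (theta_completion a \<theta>).
        completion_abs a \<theta> (F \<ominus>\<^bsub>theta_completion a \<theta>\<^esub> G) < ereal \<epsilon>}"

text \<open>Balls need not be open, so they are only required to form a base of neighbourhoods.\<close>

definition inframetric_topology :: "int \<Rightarrow> real \<Rightarrow> (nat \<Rightarrow> real) set topology" where
  "inframetric_topology a \<theta> =
     (THE T. topspace T = carrier (theta_completion a \<theta>) \<and>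
        (\<forall>F \<in> carrier (theta_completion a \<theta>). \<forall>U.
           (\<exists>V. openin T V \<and> F \<in> V \<and> V \<subseteq> U) \<longleftrightarrow>
           (\<exists>\<epsilon>>0. inframetric_ball a \<theta> F \<epsilon> \<subseteq> U)))"

end

theory Submission
  imports Defs
begin

text \<open>
  If \<open>\<alpha> = \<plusminus>\<Sum>\<^sub>i b\<^sub>i \<theta>\<^sup>i\<close> is greedy with lowest exponent \<open>m\<close>, then \<open>\<alpha>' = \<plusminus>(- 1 / \<theta>)\<^sup>m S\<close> where
  \<open>S\<close> is an alternating digit sum, and comparing with geometric series gives
  \<open>1 / \<theta> < S < \<theta>\<close>. So \<open>\<bar>\<alpha>\<bar>\<^sub>\<theta>\<close> and \<open>\<bar>\<alpha>'\<bar>\<close> differ at most by a factor \<open>\<theta>\<close>, and Cauchy and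
  null sequences for \<open>\<bar>\<cdot>\<bar>\<^sub>\<theta>\<close> are those whose conjugates are Cauchy, respectively null, in \<open>\<real>\<close>.
  The limit of the conjugates is thus a ring homomorphism onto \<open>\<real>\<close> (the conjugates of
  \<open>\<int>[\<theta>]\<close> are dense) whose kernel is the null ideal, and it compares the balls of the completion with
  real intervals.
\<close>

section \<open>Existence of greedy expansions\<close>


locale quadratic_unit =
  fixes a :: int and \<theta> :: real
  assumes a_ge_1: "a \<ge> 1" and theta_gt_1: "\<theta> > 1" and theta_sq: "\<theta>\<^sup>2 = of_int a * \<theta> + 1"
begin

text \<open>The powers of \<theta> accumulate only at 0 and at infinity. This discreteness is used
  twice: to have finitely many representations of a given size, and to have finitely many limits
  superior in a nonzero class of the completion.\<close>

lemma finite_powi_between: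
  assumes "0 < c"
  shows "finite {i::int. c \<le> \<theta> powi i \<and> \<theta> powi i \<le> d}"
proof -
  obtain n where n: "d < \<theta> ^ n" using real_arch_pow theta_gt_1 by blast
  obtain m where m: "1 / c < \<theta> ^ m" using real_arch_pow theta_gt_1 by blast
  have "i \<in> {- int m..int n}" if "c \<le> \<theta> powi i" "\<theta> powi i \<le> d" for i
  proof -
    have "\<theta> powi i < \<theta> powi int n" using that n by simp
    hence "i \<le> int n"
      using power_int_increasing[of "int n" i \<theta>] theta_gt_1 by (cases "i \<le> int n") auto
    moreover have "\<theta> powi (- int m) < c"
      using m assms theta_gt_1 by (simp add: power_int_minus field_simps)
    hence "\<theta> powi (- int m) < \<theta> powi i" using that by simp
    hence "- int m \<le> i"
      using power_int_increasing[of i "- int m" \<theta>] theta_gt_1 by (cases "- int m \<le> i") auto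
    ultimately show ?thesis by simp
  qed
  thus ?thesis by (intro finite_subset[OF _ finite_atLeastAtMost_int[of "- int m" "int n"]]) blast
qed

lemma powi_rec: "\<theta> powi (i + 1) = of_int a * \<theta> powi i + \<theta> powi (i - 1)"
proof -
  have "\<theta> powi (i + 1) = \<theta> powi (i - 1) * \<theta> powi 2" "\<theta> powi i = \<theta> powi (i - 1) * \<theta> powi 1"
    using theta_gt_1 power_int_add[of \<theta> "i - 1" 2] power_int_add[of \<theta> "i - 1" 1]
    by (simp_all add: algebra_simps)
  thus ?thesis using theta_sq by (simp add: algebra_simps)
qed

text \<open>Multisets of exponents encode polynomials in \<theta> and 1 / \<theta> with nonnegative
  coefficients: the multiplicity of \<open>i\<close> is the digit at \<open>i\<close>, and the size
  is the digit sum. Rewriting of digits becomes an exchange of submultisets.\<close>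

definition pow_sum :: "int multiset \<Rightarrow> real" where
  "pow_sum M = (\<Sum>i\<in>#M. \<theta> powi i)"

lemma pow_sum_simps [simp]:
  "pow_sum {#} = 0" "pow_sum (add_mset i M) = \<theta> powi i + pow_sum M"
  "pow_sum (M + N) = pow_sum M + pow_sum N" "pow_sum (replicate_mset n i) = of_nat n * \<theta> powi i"
  by (simp_all add: pow_sum_def)

lemma pow_sum_nonneg: "pow_sum M \<ge> 0"
  using theta_gt_1 by (induction M) auto

lemma pow_sum_shift: "pow_sum (image_mset (\<lambda>i. i + k) M) = \<theta> powi k * pow_sum M"
  using theta_gt_1 by (induction M) (auto simp: algebra_simps power_int_add)

text \<open>The largest exponent is a witness. As each single power is at most the whole sum, size
  and value together confine this exponent to a bounded window.\<close>

lemma pow_sum_le_top: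
  assumes "M \<noteq> {#}"
  shows "\<exists>i\<in>#M. pow_sum M \<le> of_nat (size M) * \<theta> powi i"
proof -
  let ?i = "Max (set_mset M)"
  \<comment> \<open>The induction runs over submultisets so that the maximum of all of
    \<open>M\<close> stays fixed.\<close>
  have "pow_sum N \<le> of_nat (size N) * \<theta> powi ?i" if "N \<subseteq># M" for N
    using that
  proof (induction N)
    case (add j N)
    have "j \<le> ?i" using add.prems by (simp add: insert_subset_eq_iff)
    hence "\<theta> powi j \<le> \<theta> powi ?i" using theta_gt_1 by (intro power_int_increasing) auto
    moreover have "N \<subseteq># M" using add.prems subset_mset.order_trans[of N "add_mset j N" M] by simp
    ultimately show ?case using add.IH by (simp add: algebra_simps)
  qed simp
  moreover have "?i \<in># M" using assms by simp
  ultimately show ?thesis by blast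
qed

text \<open>Removing the largest exponent leaves a representation of smaller size, and
  \<open>pow_sum_le_top\<close> leaves finitely many choices for that exponent. The value changes
  with the removal, so the induction keeps \<open>x\<close> arbitrary.\<close>

lemma finite_pow_sum_reps: "finite {M. size M = n \<and> pow_sum M = x}"
proof (induction n arbitrary: x)
  case (Suc n)
  define I where "I = {i::int. x / of_nat (Suc n) \<le> \<theta> powi i \<and> \<theta> powi i \<le> x}"
  have sub: "{M. size M = Suc n \<and> pow_sum M = x} \<subseteq>
      (\<Union>i\<in>I. add_mset i ` {M. size M = n \<and> pow_sum M = x - \<theta> powi i})"
  proof
    fix M assume "M \<in> {M. size M = Suc n \<and> pow_sum M = x}"
    hence M: "size M = Suc n" "pow_sum M = x" by auto
    hence "M \<noteq> {#}" by auto
    then obtain i where i: "i \<in># M" "x \<le> of_nat (Suc n) * \<theta> powi i"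
      using pow_sum_le_top M by metis
    obtain N where N: "M = add_mset i N" using i(1) by (meson multi_member_split)
    have "i \<in> I" using i(2) M(2) pow_sum_nonneg[of N] by (simp add: I_def N field_simps)
    thus "M \<in> (\<Union>i\<in>I. add_mset i ` {M. size M = n \<and> pow_sum M = x - \<theta> powi i})"
      using M by (intro UN_I[of i] image_eqI[of _ _ N]) (auto simp: N)
  qed
  show ?case
  proof (cases "x > 0")
    case True
    hence "finite I" unfolding I_def by (intro finite_powi_between) simp
    thus ?thesis using Suc by (intro finite_subset[OF sub]) auto
  next
    case False
    have "\<theta> powi i > 0" for i using theta_gt_1 by simp
    hence "I = {}" using False by (auto simp: I_def not_less) (smt (verit))
    thus ?thesis using finite_subset[OF sub] by simp
  qed
qed simp

lemma sum_image_mset_eq_sum_count: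
  fixes f :: "'a \<Rightarrow> real"
  assumes "finite A" "set_mset M \<subseteq> A"
  shows "(\<Sum>x\<in>#M. f x) = (\<Sum>x\<in>A. of_nat (count M x) * f x)"
  using assms(2)
proof (induction M)
  case (add y M)
  have "(\<Sum>x\<in>A. of_nat (count (add_mset y M) x) * f x) =
      (\<Sum>x\<in>A. of_nat (count M x) * f x + (if x = y then f x else 0))"
    by (intro sum.cong) (auto simp: algebra_simps)
  also have "\<dots> = (\<Sum>x\<in>A. of_nat (count M x) * f x) + f y"
    using add.prems assms(1) by (simp add: sum.distrib)
  finally show ?case using add by simp
qed simp

lemma greedy_value_count: "greedy_value \<theta> (\<lambda>i. int (count M i)) = pow_sum M"
proof -
  have "pow_sum M = (\<Sum>i\<in>set_mset M. of_nat (count M i) * \<theta> powi i)"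
    unfolding pow_sum_def by (rule sum_image_mset_eq_sum_count) auto
  thus ?thesis by (simp add: greedy_value_def)
qed

text \<open>
  A representation by a multiset of powers that has minimal size cannot be shortened by
  \<open>a \<theta>\<^sup>i + \<theta>\<^sup>i\<^sup>-\<^sup>1 = \<theta>\<^sup>i\<^sup>+\<^sup>1\<close>. The rule
  \<open>(a + 1) \<theta>\<^sup>i = \<theta>\<^sup>i\<^sup>+\<^sup>1 + (a - 1) \<theta>\<^sup>i\<^sup>-\<^sup>1 + \<theta>\<^sup>i\<^sup>-\<^sup>2\<close> preserves the size but increases the sum of the
  powers of \<open>a + 1\<close> with the same exponents; as there are only finitely many representations of
  the same size, one that maximises this sum is greedy.
\<close>

lemma greedy_digits_of_pow_sum:
  "\<exists>b. greedy_digits a b \<and> greedy_value \<theta> b = pow_sum M"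
proof -
  define n where "n = (LEAST n. \<exists>N. size N = n \<and> pow_sum N = pow_sum M)"
  define A where "A = {N. size N = n \<and> pow_sum N = pow_sum M}"
  \<comment> \<open>With this base, (a + 1) w^i = w^(i+1). The exchange that preserves the size
    therefore changes \<open>f\<close> by the terms at i - 1 and i - 2 alone, which add up to
    something positive.\<close>
  define w :: real where "w = of_int a + 1"
  define f where "f N = (\<Sum>i\<in>#N. w powi i)" for N
  have w: "w > 0" using a_ge_1 by (simp add: w_def)
  have "\<exists>N. size N = n \<and> pow_sum N = pow_sum M"
    unfolding n_def by (rule LeastI_ex) blast
  hence "A \<noteq> {}" by (auto simp: A_def)
  have minimal: "n \<le> size N" if "pow_sum N = pow_sum M" for N
    unfolding n_def by (rule Least_le) (use that in blast)
  have "finite (f ` A)" unfolding A_def by (intro finite_imageI finite_pow_sum_reps)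
  hence "Max (f ` A) \<in> f ` A" and Max_ge: "\<forall>N\<in>A. f N \<le> Max (f ` A)"
    using \<open>A \<noteq> {}\<close> by auto
  then obtain N where N: "N \<in> A" and maximal: "\<And>N'. N' \<in> A \<Longrightarrow> f N' \<le> f N"
    by (metis imageE)
  obtain a' where a': "a = int a'" "a' \<ge> 1" using a_ge_1 by (metis nat_0_le nat_mono nat_one_as_int nat_1 order.trans zero_le_one)
  have adjacent: "count N (i - 1) = 0" if "count N i \<ge> a'" for i
  proof (rule ccontr)
    assume "count N (i - 1) \<noteq> 0"
    hence "replicate_mset a' i + {#i - 1#} \<subseteq># N"
      using that by (auto simp: subseteq_mset_def count_eq_zero_iff)
    then obtain R where R: "N = replicate_mset a' i + {#i - 1#} + R"
      by (auto simp: mset_subset_eq_exists_conv)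
    have "pow_sum (add_mset (i + 1) R) = pow_sum N"
      using powi_rec[of i] by (simp add: R a')
    hence "pow_sum (add_mset (i + 1) R) = pow_sum M" using N by (simp add: A_def)
    hence "n \<le> size (add_mset (i + 1) R)" by (rule minimal)
    thus False using N a' by (simp add: A_def R)
  qed
  have le_a: "count N i \<le> a'" for i
  proof (rule ccontr)
    assume "\<not> count N i \<le> a'"
    hence "Suc a' \<le> count N i" by simp
    hence "replicate_mset (Suc a') i \<subseteq># N"
      by (simp only: count_le_replicate_mset_subset_eq)
    then obtain R where R: "N = replicate_mset (Suc a') i + R"
      by (auto simp: mset_subset_eq_exists_conv)
    \<comment> \<open>One copy of \<theta>^i is expanded downwards into a copies of \<theta>^(i-1)
      and one \<theta>^(i-2); one of these \<theta>^(i-1) then combines with the other a copies of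
      \<theta>^i into \<theta>^(i+1). For a = 1 the block at i - 1 is empty.\<close>
    define N' where "N' = replicate_mset (a' - 1) (i - 1) + {#i + 1, i - 2#} + R"
    have "pow_sum N' = pow_sum N"
      using powi_rec[of i] powi_rec[of "i - 1"] a' by (simp add: R N'_def algebra_simps)
    moreover have "size N' = size N" using a' by (simp add: N'_def R)
    ultimately have "N' \<in> A" using N by (simp add: A_def)
    moreover have "f N' > f N"
    proof -
      have "f N' = w powi (i + 1) + real (a' - 1) * w powi (i - 1) + w powi (i - 2) + f R"
        by (simp add: f_def N'_def)
      moreover have "f N = w powi (i + 1) + f R"
        using w by (simp add: f_def R power_int_add w_def a' algebra_simps)
      moreover have "0 \<le> real (a' - 1) * w powi (i - 1)" "0 < w powi (i - 2)"
        using w by simp_all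
      ultimately show ?thesis by linarith
    qed
    ultimately show False using maximal by force
  qed
  define b where "b = (\<lambda>i. int (count N i))"
  have "finite {i. b i \<noteq> 0}" by (simp add: b_def)
  hence "greedy_digits a b"
    using adjacent le_a by (auto simp: greedy_digits_def b_def a')
  moreover have "greedy_value \<theta> b = pow_sum M"
    using N by (simp add: b_def greedy_value_count A_def)
  ultimately show ?thesis by blast
qed

text \<open>Nonnegative coefficients give a representation with exponents 0 and 1. Otherwise the
  signs differ, and multiplication by \<theta> turns (m, n) into (n, m + n a), which either is
  nonnegative or has a smaller sum of absolute values. Shifting the exponents by -1 undoes the
  multiplication.\<close>

lemma pow_sum_rep:
  assumes "of_int m + of_int n * \<theta> > 0"
  shows "\<exists>M. pow_sum M = of_int m + of_int n * \<theta>"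
  using assms
proof (induction "nat (\<bar>m\<bar> + \<bar>n\<bar>)" arbitrary: m n rule: less_induct)
  case less
  show ?case
  proof (cases "m \<ge> 0 \<and> n \<ge> 0")
    case True
    thus ?thesis
      by (intro exI[of _ "replicate_mset (nat m) 0 + replicate_mset (nat n) 1"]) simp
  next
    case False
    let ?k = "m + n * a"
    have "\<theta> * (of_int m + of_int n * \<theta>) = of_int m * \<theta> + of_int n * \<theta>\<^sup>2"
      by (simp add: algebra_simps power2_eq_square)
    hence eq: "\<theta> * (of_int m + of_int n * \<theta>) = of_int n + of_int ?k * \<theta>"
      by (simp add: theta_sq algebra_simps)
    hence pos: "of_int n + of_int ?k * \<theta> > 0"
      using less.prems theta_gt_1 by (metis mult_pos_pos order.strict_trans zero_less_one)
    have rep: "\<exists>M. pow_sum M = of_int m + of_int n * \<theta>"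
      if "pow_sum M = of_int n + of_int ?k * \<theta>" for M
    proof -
      have "pow_sum (image_mset (\<lambda>i. i + (- 1)) M) = of_int m + of_int n * \<theta>"
        unfolding pow_sum_shift that eq[symmetric]
        using theta_gt_1 by (simp add: power_int_minus)
      thus ?thesis by blast
    qed
    have neg: "of_int u + of_int v * \<theta> \<le> 0" if "u \<le> 0" "v \<le> 0" for u v :: int
      using that theta_gt_1 by (simp add: add_nonpos_nonpos mult_nonpos_nonneg)
    have mn: "m < 0 \<and> n > 0 \<or> m > 0 \<and> n < 0"
      using False less.prems neg[of m n] by force
    show ?thesis
    proof (cases "n > 0 \<and> ?k \<ge> 0")
      case True
      hence "pow_sum (replicate_mset (nat n) 0 + replicate_mset (nat ?k) 1) = of_int n + of_int ?k * \<theta>"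
        by simp
      thus ?thesis by (rule rep)
    next
      case n: False
      \<comment> \<open>For n > 0 the remaining case has m < \<open>?k\<close> < 0. For n < 0
        positivity of the product forces \<open>?k\<close> > 0, while n a < 0 gives
        \<open>?k\<close> < m.\<close>
      have "\<bar>?k\<bar> < \<bar>m\<bar>"
      proof (cases "n > 0")
        case True
        hence "n * a > 0" using a_ge_1 by simp
        thus ?thesis using n mn True by auto
      next
        case False
        hence "n * a < 0" using a_ge_1 mn by (simp add: mult_neg_pos)
        moreover have "?k > 0" using neg[of n ?k] pos False by force
        ultimately show ?thesis by auto
      qed
      hence "nat (\<bar>n\<bar> + \<bar>?k\<bar>) < nat (\<bar>m\<bar> + \<bar>n\<bar>)" by auto
      from less.hyps[OF this pos] show ?thesis using rep by blast
    qed
  qed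
qed

lemma ex_greedy_expansion:
  assumes "x \<in> int_adjoin \<theta>" "x \<noteq> 0"
  shows "\<exists>b. greedy_expansion a \<theta> b x"
proof -
  obtain m n where x: "x = of_int m + of_int n * \<theta>" using assms by (auto simp: int_adjoin_def)
  have "x > 0 \<or> - x > 0" using assms(2) by auto
  then obtain M where "pow_sum M = x \<or> pow_sum M = - x"
    using pow_sum_rep[of m n] pow_sum_rep[of "- m" "- n"] by (auto simp: x)
  moreover obtain b where "greedy_digits a b" "greedy_value \<theta> b = pow_sum M"
    using greedy_digits_of_pow_sum by blast
  ultimately show ?thesis unfolding greedy_expansion_def by force
qed

section \<open>Conjugates of greedy polynomials\<close>

abbreviation \<eta> :: real where "\<eta> \<equiv> - 1 / \<theta>"

lemma theta_eq: "\<theta> = of_int a + 1 / \<theta>"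
proof -
  have "\<theta> * (\<theta> - of_int a) = 1" using theta_sq by (simp add: algebra_simps power2_eq_square)
  hence "inverse \<theta> = \<theta> - of_int a" by (rule inverse_unique)
  thus ?thesis by (simp add: inverse_eq_divide)
qed

lemma eta_sq: "\<eta>\<^sup>2 = of_int a * \<eta> + 1"
proof -
  have eta: "\<eta> = of_int a - \<theta>" using theta_eq by simp
  have "\<eta>\<^sup>2 = of_int a * of_int a - 2 * of_int a * \<theta> + \<theta>\<^sup>2"
    unfolding eta by (simp add: algebra_simps power2_eq_square)
  also have "\<dots> = of_int a * (of_int a - \<theta>) + 1" by (simp add: theta_sq algebra_simps)
  finally show ?thesis by (simp only: eta)
qed

text \<open>A rational algebraic integer is an integer, and \<theta> (\<theta> - a) = 1 would make
  the integer \<theta> > 1 a divisor of 1.\<close>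

lemma theta_irrational: "\<theta> \<notin> \<rat>"
proof
  assume "\<theta> \<in> \<rat>"
  moreover have "algebraic_int \<theta>"
  proof (rule algebraic_int.intros)
    let ?p = "[:- 1, of_int (- a), 1:] :: real poly"
    show "Polynomial.lead_coeff ?p = 1" by simp
    show "\<forall>i. Polynomial.coeff ?p i \<in> \<int>"
      by (auto simp: coeff_pCons split: nat.splits)
    show "poly ?p \<theta> = 0" using theta_sq by (simp add: algebra_simps power2_eq_square)
  qed
  ultimately have "\<theta> \<in> \<int>" by (simp add: rational_algebraic_int_is_int)
  then obtain k where k: "\<theta> = of_int k" by (auto elim: Ints_cases)
  have "of_int (k * (k - a)) = (1 :: real)"
    using theta_sq by (simp add: k algebra_simps power2_eq_square)
  hence "k * (k - a) = 1" by linarith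
  moreover have "k > 1" using theta_gt_1 by (simp add: k)
  ultimately show False by (simp add: zmult_eq_1_iff)
qed

text \<open>Irrationality of \<theta> makes the coordinates unique, so the definite description in
  \<open>galois_conj\<close> denotes.\<close>

lemma galois_conj_eq:
  "galois_conj \<theta> (of_rat p + of_rat q * \<theta>) = of_rat p + of_rat q * \<eta>"
  unfolding galois_conj_def
proof (rule the_equality)
  fix \<beta>
  assume "\<exists>p' q'. of_rat p + of_rat q * \<theta> = of_rat p' + of_rat q' * \<theta> \<and> \<beta> = of_rat p' + of_rat q' * \<eta>"
  then obtain p' q' where eq: "of_rat p + of_rat q * \<theta> = of_rat p' + of_rat q' * \<theta>"
    and \<beta>: "\<beta> = of_rat p' + of_rat q' * \<eta>" by blast
  have "q = q'"
  proof (rule ccontr)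
    assume "q \<noteq> q'"
    hence "(of_rat q - of_rat q' :: real) \<noteq> 0" by simp
    moreover have "(of_rat q - of_rat q') * \<theta> = of_rat p' - of_rat p"
      using eq by (simp add: algebra_simps)
    ultimately have "\<theta> = of_rat ((p' - p) / (q - q'))"
      by (simp add: of_rat_divide of_rat_diff field_simps)
    thus False using theta_irrational by auto
  qed
  with eq \<beta> show "\<beta> = of_rat p + of_rat q * \<eta>" by simp
qed blast

lemma galois_conj_int [simp]:
  "galois_conj \<theta> (of_int m + of_int n * \<theta>) = of_int m + of_int n * \<eta>"
  using galois_conj_eq[of "of_int m" "of_int n"] by simp

section \<open>Arithmetic in \<int>[\<theta>] and its conjugation\<close>

abbreviation O\<theta> :: "real set" where "O\<theta> \<equiv> int_adjoin \<theta>"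

lemma int_adjoinE:
  assumes "x \<in> O\<theta>" obtains m n where "x = of_int m + of_int n * \<theta>"
  using assms unfolding int_adjoin_def by blast

lemma int_adjoinI: "of_int m + of_int n * \<theta> \<in> O\<theta>"
  unfolding int_adjoin_def by blast

lemma int_adjoin_of_int: "of_int k \<in> O\<theta>" and galois_conj_of_int: "galois_conj \<theta> (of_int k) = of_int k"
  using int_adjoinI[of k 0] galois_conj_int[of k 0] by simp_all

lemma int_adjoin_add:
  assumes "x \<in> O\<theta>" "y \<in> O\<theta>"
  shows "x + y \<in> O\<theta>" and galois_conj_add: "galois_conj \<theta> (x + y) = galois_conj \<theta> x + galois_conj \<theta> y"
proof -
  obtain m n m' n' where xy: "x = of_int m + of_int n * \<theta>" "y = of_int m' + of_int n' * \<theta>"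
    using assms by (elim int_adjoinE)
  have eq: "x + y = of_int (m + m') + of_int (n + n') * \<theta>"
    by (simp add: xy algebra_simps)
  show "x + y \<in> O\<theta>" unfolding eq by (rule int_adjoinI)
  show "galois_conj \<theta> (x + y) = galois_conj \<theta> x + galois_conj \<theta> y"
    unfolding eq galois_conj_int unfolding xy galois_conj_int by (simp add: algebra_simps add_divide_distrib)
qed

lemma int_adjoin_mult:
  assumes "x \<in> O\<theta>" "y \<in> O\<theta>"
  shows "x * y \<in> O\<theta>" and galois_conj_mult: "galois_conj \<theta> (x * y) = galois_conj \<theta> x * galois_conj \<theta> y"
proof -
  obtain m n m' n' where xy: "x = of_int m + of_int n * \<theta>" "y = of_int m' + of_int n' * \<theta>"
    using assms by (elim int_adjoinE)
  \<comment> \<open>The product formula depends only on the quadratic equation, so the same integer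
    coefficients serve for \<theta> and for \<eta>. This is why conjugation is
    multiplicative.\<close>
  have prod: "(of_int m + of_int n * t) * (of_int m' + of_int n' * t) =
      of_int (m * m' + n * n') + of_int (m * n' + n * m' + n * n' * a) * t"
    if "t\<^sup>2 = of_int a * t + 1" for t :: real
  proof -
    have "(of_int m + of_int n * t) * (of_int m' + of_int n' * t) =
        of_int (m * m') + of_int (m * n' + n * m') * t + of_int (n * n') * t\<^sup>2"
      by (simp add: algebra_simps power2_eq_square)
    thus ?thesis by (simp add: that algebra_simps)
  qed
  show "x * y \<in> O\<theta>" unfolding xy prod[OF theta_sq] by (rule int_adjoinI)
  show "galois_conj \<theta> (x * y) = galois_conj \<theta> x * galois_conj \<theta> y"
    unfolding xy prod[OF theta_sq] galois_conj_int prod[OF eta_sq] by (rule refl)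
qed

lemma int_adjoin_0: "0 \<in> O\<theta>" and galois_conj_0: "galois_conj \<theta> 0 = 0"
  and int_adjoin_1: "1 \<in> O\<theta>" and galois_conj_1: "galois_conj \<theta> 1 = 1"
  using int_adjoin_of_int[of 0] galois_conj_of_int[of 0] int_adjoin_of_int[of 1] galois_conj_of_int[of 1]
  by simp_all

lemma int_adjoin_minus:
  assumes "x \<in> O\<theta>"
  shows "- x \<in> O\<theta>" and galois_conj_minus: "galois_conj \<theta> (- x) = - galois_conj \<theta> x"
  using int_adjoin_mult[OF int_adjoin_of_int[of "- 1"] assms] galois_conj_mult[OF int_adjoin_of_int[of "- 1"] assms]
    galois_conj_of_int[of "- 1"]
  by simp_all

lemma int_adjoin_diff:
  assumes "x \<in> O\<theta>" "y \<in> O\<theta>"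
  shows "x - y \<in> O\<theta>" and galois_conj_diff: "galois_conj \<theta> (x - y) = galois_conj \<theta> x - galois_conj \<theta> y"
  using int_adjoin_add[OF assms(1) int_adjoin_minus(1)[OF assms(2)]]
    galois_conj_add[OF assms(1) int_adjoin_minus(1)[OF assms(2)]] galois_conj_minus[OF assms(2)]
  by simp_all

lemma int_adjoin_power:
  assumes "x \<in> O\<theta>"
  shows "x ^ n \<in> O\<theta> \<and> galois_conj \<theta> (x ^ n) = galois_conj \<theta> x ^ n"
  by (induction n) (simp_all add: assms int_adjoin_1 galois_conj_1 int_adjoin_mult galois_conj_mult)

lemma int_adjoin_powi: "\<theta> powi i \<in> O\<theta>"
  and galois_conj_powi: "galois_conj \<theta> (\<theta> powi i) = \<eta> powi i"
proof -
  have theta: "\<theta> \<in> O\<theta>" "galois_conj \<theta> \<theta> = \<eta>"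
    using int_adjoinI[of 0 1] galois_conj_int[of 0 1] by simp_all
  have "inverse \<theta> = of_int (- a) + of_int 1 * \<theta>"
    using theta_eq by (simp add: inverse_eq_divide)
  moreover have "inverse \<eta> = - \<theta>" by (simp add: inverse_eq_divide)
  hence "inverse \<eta> = of_int (- a) + of_int 1 * \<eta>" using theta_eq by simp
  ultimately have "inverse \<theta> = of_int (- a) + of_int 1 * \<theta>" "inverse \<eta> = of_int (- a) + of_int 1 * \<eta>"
    by blast+
  hence inv: "inverse \<theta> \<in> O\<theta>" "galois_conj \<theta> (inverse \<theta>) = inverse \<eta>"
    using int_adjoinI[of "- a" 1] galois_conj_int[of "- a" 1] by simp_all
  have "\<theta> ^ n \<in> O\<theta> \<and> galois_conj \<theta> (\<theta> ^ n) = \<eta> ^ n" for n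
    using int_adjoin_power[OF theta(1)] by (simp only: theta(2))
  moreover have "inverse \<theta> ^ n \<in> O\<theta> \<and> galois_conj \<theta> (inverse \<theta> ^ n) = inverse \<eta> ^ n" for n
    using int_adjoin_power[OF inv(1)] by (simp only: inv(2))
  ultimately show "\<theta> powi i \<in> O\<theta>" "galois_conj \<theta> (\<theta> powi i) = \<eta> powi i"
    unfolding power_int_def by (cases "i \<ge> 0"; simp only: if_True if_False)+
qed

lemma galois_conj_greedy_value: "galois_conj \<theta> (greedy_value \<theta> b) = greedy_value \<eta> b"
proof -
  define f g where "f i = of_int (b i) * \<theta> powi i" and "g i = of_int (b i) * \<eta> powi i" for i
  have f: "f i \<in> O\<theta>" for i
    unfolding f_def by (intro int_adjoin_mult int_adjoin_of_int int_adjoin_powi)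
  have g: "galois_conj \<theta> (f i) = g i" for i
    unfolding f_def g_def galois_conj_mult[OF int_adjoin_of_int int_adjoin_powi]
      galois_conj_of_int galois_conj_powi by (rule refl)
  have "sum f I \<in> O\<theta> \<and> galois_conj \<theta> (sum f I) = sum g I" for I
  proof (induction I rule: infinite_finite_induct)
    case (insert i I)
    have "sum f (insert i I) = f i + sum f I" "sum g (insert i I) = g i + sum g I"
      using insert.hyps by (rule sum.insert)+
    thus ?case
      using int_adjoin_add(1)[OF f] galois_conj_add[OF f] insert.IH by (simp add: g)
  qed (simp_all add: int_adjoin_0 galois_conj_0)
  hence "galois_conj \<theta> (sum f {i. b i \<noteq> 0}) = sum g {i. b i \<noteq> 0}" by blast
  thus ?thesis unfolding f_def g_def greedy_value_def by assumption
qed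

section \<open>Bounds for alternating digit sums\<close>

lemma digit_sum_Suc:
  "(\<Sum>j<Suc n. of_int (c j) * \<eta> ^ j) = of_int (c 0) - (\<Sum>j<n. of_int (c (Suc j)) * \<eta> ^ j) / \<theta>"
proof -
  have "(\<Sum>j<n. of_int (c (Suc j)) * e ^ Suc j) = e * (\<Sum>j<n. of_int (c (Suc j)) * e ^ j)" for e :: real
    unfolding sum_distrib_left by (intro sum.cong) (simp_all add: mult_ac)
  from this[of \<eta>] show ?thesis unfolding sum.lessThan_Suc_shift by simp
qed

text \<open>By the Horner step \<open>digit_sum_Suc\<close>, a new digit c replaces the sum S by c -
  S / \<theta>. For 0 \<le> c \<le> a this maps the open interval from -1 to \<theta> into itself,
  because a + 1 / \<theta> = \<theta>.\<close>

lemma digit_sum_bounds: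
  assumes "\<And>j. c j \<in> {0..a}"
  shows "- 1 < (\<Sum>j<n. of_int (c j) * \<eta> ^ j)" "(\<Sum>j<n. of_int (c j) * \<eta> ^ j) < \<theta>"
proof -
  have "- 1 < (\<Sum>j<n. of_int (c j) * \<eta> ^ j) \<and> (\<Sum>j<n. of_int (c j) * \<eta> ^ j) < \<theta>"
    using assms
  proof (induction n arbitrary: c)
    case 0
    show ?case using theta_gt_1 by simp
  next
    case (Suc n)
    define S where "S = (\<Sum>j<n. of_int (c (Suc j)) * \<eta> ^ j)"
    have eq: "(\<Sum>j<Suc n. of_int (c j) * \<eta> ^ j) = of_int (c 0) - S / \<theta>"
      unfolding S_def by (rule digit_sum_Suc)
    have S: "- 1 < S" "S < \<theta>" using Suc.IH[of "\<lambda>j. c (Suc j)"] Suc.prems by (auto simp: S_def)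
    have "S / \<theta> < 1" "- (1 / \<theta>) < S / \<theta>" using S theta_gt_1 by (simp_all add: field_simps)
    moreover have "0 \<le> real_of_int (c 0)" "real_of_int (c 0) \<le> of_int a" using Suc.prems[of 0] by auto
    ultimately show ?case unfolding eq using theta_eq by linarith
  qed
  thus "- 1 < (\<Sum>j<n. of_int (c j) * \<eta> ^ j)" "(\<Sum>j<n. of_int (c j) * \<eta> ^ j) < \<theta>" by auto
qed

text \<open>Two Horner steps are peeled off. The tail exceeds -1 and the second digit is at most a -
  1, so what is subtracted from the first digit is less than (a - 1 + 1 / \<theta>) / \<theta> = 1 -
  1 / \<theta>.\<close>

lemma digit_sum_lower_bound:
  assumes "\<And>j. c j \<in> {0..a}" "c 0 \<noteq> 0" "c 1 \<noteq> a"
  shows "1 / \<theta> < (\<Sum>j<Suc (Suc n). of_int (c j) * \<eta> ^ j)"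
proof -
  define S where "S = (\<Sum>j<n. of_int (c (Suc (Suc j))) * \<eta> ^ j)"
  have eq: "(\<Sum>j<Suc (Suc n). of_int (c j) * \<eta> ^ j) = of_int (c 0) - (of_int (c 1) - S / \<theta>) / \<theta>"
    by (simp only: S_def digit_sum_Suc One_nat_def)
  have "- 1 < S" unfolding S_def by (rule digit_sum_bounds(1)) (rule assms(1))
  hence "- (1 / \<theta>) < S / \<theta>" using theta_gt_1 by (simp add: field_simps)
  moreover have "c 1 \<le> a - 1" "1 \<le> c 0" using assms(1)[of 0] assms(1)[of 1] assms(2,3) by auto
  hence "real_of_int (c 1) \<le> of_int a - 1" "1 \<le> real_of_int (c 0)" by linarith+
  ultimately have "of_int (c 1) - S / \<theta> < \<theta> - 1" using theta_eq by linarith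
  hence "(of_int (c 1) - S / \<theta>) / \<theta> < (\<theta> - 1) / \<theta>"
    using theta_gt_1 by (intro divide_strict_right_mono) auto
  hence "(of_int (c 1) - S / \<theta>) / \<theta> < 1 - 1 / \<theta>"
    using theta_gt_1 by (simp add: diff_divide_distrib)
  thus ?thesis unfolding eq using \<open>1 \<le> real_of_int (c 0)\<close> by linarith
qed

lemma greedy_value_conj_bounds:
  assumes b: "greedy_digits a b" and m: "b m \<noteq> 0" "\<And>i. i < m \<Longrightarrow> b i = 0"
  obtains S where "greedy_value \<eta> b = \<eta> powi m * S" "1 / \<theta> < S" "S < \<theta>"
proof -
  have fin: "finite {i. b i \<noteq> 0}" and digits: "\<And>i. b i \<in> {0..a}"
    using b by (auto simp: greedy_digits_def)
  define n where "n = nat (Max {i. b i \<noteq> 0} - m)"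
  have ub: "i \<le> m + int n" if "b i \<noteq> 0" for i
  proof -
    have "i \<le> Max {i. b i \<noteq> 0}" using fin that by auto
    thus ?thesis by (simp add: n_def)
  qed
  \<comment> \<open>The digits reach up to exponent m + n, so the last term is a zero digit. The
    padding guarantees the two leading terms that \<open>digit_sum_lower_bound\<close> peels
    off.\<close>
  define S where "S = (\<Sum>j<Suc (Suc n). of_int (b (m + int j)) * \<eta> ^ j)"
  have "greedy_value \<eta> b = (\<Sum>i\<in>(\<lambda>j. m + int j) ` {..<Suc (Suc n)}. of_int (b i) * \<eta> powi i)"
    unfolding greedy_value_def
  proof (rule sum.mono_neutral_left)
    show "{i. b i \<noteq> 0} \<subseteq> (\<lambda>j. m + int j) ` {..<Suc (Suc n)}"
    proof
      fix i assume "i \<in> {i. b i \<noteq> 0}"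
      hence "m \<le> i" "i \<le> m + int n" using m(2) ub by force+
      thus "i \<in> (\<lambda>j. m + int j) ` {..<Suc (Suc n)}"
        by (intro image_eqI[of _ _ "nat (i - m)"]) auto
    qed
  qed auto
  also have "\<dots> = (\<Sum>j<Suc (Suc n). of_int (b (m + int j)) * \<eta> powi (m + int j))"
    by (subst sum.reindex) (auto simp: inj_on_def)
  also have "\<dots> = \<eta> powi m * S"
    unfolding S_def sum_distrib_left using theta_gt_1
    by (intro sum.cong) (auto simp: power_int_add mult_ac)
  finally have eq: "greedy_value \<eta> b = \<eta> powi m * S" .
  \<comment> \<open>The greedy condition at m + 1 would force the lowest digit to vanish.\<close>
  have "b (m + 1) \<noteq> a" using b m(1) by (auto simp: greedy_digits_def)
  hence "1 / \<theta> < S" unfolding S_def using digits m(1) by (intro digit_sum_lower_bound) auto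
  moreover have "S < \<theta>" unfolding S_def using digits by (intro digit_sum_bounds) auto
  ultimately show ?thesis using that eq by blast
qed

section \<open>The lowest exponent and the size of the conjugate\<close>

lemma greedy_value_pos:
  assumes b: "greedy_digits a b" and m: "b m \<noteq> 0"
  shows "greedy_value \<theta> b > 0"
  unfolding greedy_value_def
proof (rule sum_pos2[of _ m])
  show "finite {i. b i \<noteq> 0}" using b by (auto simp: greedy_digits_def)
  have digits: "0 \<le> b i" for i using b by (auto simp: greedy_digits_def)
  show "0 < of_int (b m) * \<theta> powi m" using digits[of m] m theta_gt_1 by simp
  show "0 \<le> of_int (b i) * \<theta> powi i" for i using digits[of i] theta_gt_1 by simp
qed (use m in simp)

text \<open>
  The interval for \<open>S\<close> has multiplicative length \<open>\<theta>\<^sup>2\<close>, so the size alone leaves two candidates for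
  the exponent; the sign distinguishes them.
\<close>

lemma lowest_exponent_unique:
  assumes S: "1 / \<theta> < S" "S < \<theta>" and T: "1 / \<theta> < T" "T < \<theta>"
    and eq: "\<eta> powi m * S = \<eta> powi n * T"
  shows "m = n"
proof -
  have *: False
    if "m < n" and S: "1 / \<theta> < S" "S < \<theta>" and T: "1 / \<theta> < T" "T < \<theta>"
      and eq: "\<eta> powi m * S = \<eta> powi n * T" for S T m n
  proof -
    define k where "k = nat (n - m)"
    have n: "n = m + int k" using \<open>m < n\<close> by (simp add: k_def)
    have "\<eta> powi m \<noteq> 0" using theta_gt_1 by simp
    hence ST: "S = \<eta> ^ k * T" using eq theta_gt_1 by (simp add: n power_int_add)
    have pos: "S > 0" "T > 0" using S T theta_gt_1 by (auto intro: order.strict_trans[rotated])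
    have "even k"
    proof (rule ccontr)
      assume "odd k"
      hence "\<eta> ^ k < 0" using theta_gt_1 by (simp add: power_less_zero_eq)
      hence "S < 0" using ST pos by (simp add: mult_neg_pos)
      thus False using pos by simp
    qed
    \<comment> \<open>The exponent difference is at least 2, so the ratio of S to T is at most
      \<theta>^(-2). This is the quotient of the endpoints 1 / \<theta> and \<theta>, which the
      strict bounds exclude.\<close>
    then obtain l where l: "k = 2 * l" "l \<ge> 1" using \<open>m < n\<close> by (auto simp: k_def elim!: evenE)
    have "\<eta> ^ k = (1 / \<theta>\<^sup>2) ^ l" unfolding l(1) power_mult by (simp add: power_divide)
    also have "\<dots> \<le> (1 / \<theta>\<^sup>2) ^ 1"
      using l(2) theta_gt_1 by (intro power_decreasing) auto
    finally have "S \<le> 1 / \<theta>\<^sup>2 * T" unfolding ST using pos by (intro mult_right_mono) auto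
    also have "\<dots> < 1 / \<theta>\<^sup>2 * \<theta>" using T theta_gt_1 by (intro mult_strict_left_mono) auto
    also have "\<dots> = 1 / \<theta>" using theta_gt_1 by (simp add: power2_eq_square)
    finally show False using S by simp
  qed
  show ?thesis using *[of m n S T] *[of n m T S] assms by (cases m n rule: linorder_cases) auto
qed

text \<open>Every expansion of x describes the same conjugate, so
  \<open>lowest_exponent_unique\<close> gives all of them the same lowest exponent m. This evaluates
  the definite description in \<open>theta_abs\<close>, and the bounds for the alternating sum
  become bounds for the conjugate since \<bar>\<eta>\<bar> = 1 / \<theta>.\<close>

lemma theta_abs_conj:
  assumes x: "x \<in> O\<theta>" "x \<noteq> 0"
  obtains k where "theta_abs a \<theta> x = \<theta> powi k"
    "\<theta> powi k / \<theta> < \<bar>galois_conj \<theta> x\<bar>" "\<bar>galois_conj \<theta> x\<bar> < \<theta> * \<theta> powi k"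
proof -
  define P where "P m b \<longleftrightarrow> greedy_expansion a \<theta> b x \<and> b m \<noteq> 0 \<and> (\<forall>i<m. b i = 0)" for m :: int and b
  have conj: "\<exists>S. galois_conj \<theta> x = sgn x * (\<eta> powi m * S) \<and> 1 / \<theta> < S \<and> S < \<theta>" if "P m b" for m b
  proof -
    have b: "greedy_digits a b" and m: "b m \<noteq> 0" "\<And>i. i < m \<Longrightarrow> b i = 0"
      and x: "x = greedy_value \<theta> b \<or> x = - greedy_value \<theta> b"
      using that by (auto simp: P_def greedy_expansion_def)
    obtain S where S: "greedy_value \<eta> b = \<eta> powi m * S" "1 / \<theta> < S" "S < \<theta>"
      using greedy_value_conj_bounds[OF b m] by blast
    \<comment> \<open>Greedy values with a nonzero digit are positive, so the sign in the expansion
      is that of x and is common to all expansions.\<close>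
    have "galois_conj \<theta> x = sgn x * greedy_value \<eta> b"
      using x greedy_value_pos[OF b m(1)] galois_conj_greedy_value[of b]
        galois_conj_minus[OF greedy_value_in_int_adjoin[OF theta_gt_1 theta_sq]]
      by auto
    thus ?thesis using S by auto
  qed
  obtain b where b: "greedy_expansion a \<theta> b x" using ex_greedy_expansion[OF x] by blast
  have "{i. b i \<noteq> 0} \<noteq> {}"
  proof
    assume "{i. b i \<noteq> 0} = {}"
    hence "greedy_value \<theta> b = 0" unfolding greedy_value_def by (simp only: sum.empty)
    thus False using b x by (auto simp: greedy_expansion_def)
  qed
  moreover have fin: "finite {i. b i \<noteq> 0}" using b by (auto simp: greedy_expansion_def greedy_digits_def)
  moreover define l where "l = Min {i. b i \<noteq> 0}"
  ultimately have "l \<in> {i. b i \<noteq> 0}" unfolding l_def by (intro Min_in)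
  moreover have "b i = 0" if "i < l" for i
    using Min_le[OF fin, of i] that by (force simp flip: l_def)
  ultimately have "P l b" using b by (simp add: P_def)
  then obtain m where m: "P m b" by blast
  have "(THE m. \<exists>b. P m b) = m"
  proof (rule the_equality)
    fix n assume "\<exists>b. P n b"
    then obtain b' where "P n b'" by blast
    from conj[OF this] obtain S where
      S: "galois_conj \<theta> x = sgn x * (\<eta> powi n * S)" "1 / \<theta> < S" "S < \<theta>" by blast
    from conj[OF m] obtain T where
      T: "galois_conj \<theta> x = sgn x * (\<eta> powi m * T)" "1 / \<theta> < T" "T < \<theta>" by blast
    have "\<eta> powi n * S = \<eta> powi m * T" using S(1) T(1) x(2) by (simp add: sgn_0_0)
    with S(2,3) T(2,3) show "n = m" by (rule lowest_exponent_unique)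
  qed (use m in blast)
  hence abs: "theta_abs a \<theta> x = \<theta> powi (- m)"
    using x(2) by (simp add: theta_abs_def P_def)
  obtain S where S: "galois_conj \<theta> x = sgn x * (\<eta> powi m * S)" "1 / \<theta> < S" "S < \<theta>"
    using conj[OF m] by blast
  have "S > 0" using S theta_gt_1 by (auto intro: order.strict_trans[rotated])
  have "\<bar>\<eta>\<bar> = inverse \<theta>" using theta_gt_1 by (simp add: field_simps)
  hence "\<bar>\<eta> powi m\<bar> = \<theta> powi (- m)"
    by (simp only: power_int_abs power_int_inverse power_int_minus)
  hence "\<bar>galois_conj \<theta> x\<bar> = \<theta> powi (- m) * S"
    using x(2) \<open>S > 0\<close> by (simp only: S(1) abs_mult abs_sgn_eq) simp
  moreover have "\<theta> powi (- m) > 0" using theta_gt_1 by simp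
  ultimately have "\<theta> powi (- m) / \<theta> < \<bar>galois_conj \<theta> x\<bar>" "\<bar>galois_conj \<theta> x\<bar> < \<theta> * \<theta> powi (- m)"
    using mult_strict_left_mono[OF S(2), of "\<theta> powi (- m)"] mult_strict_left_mono[OF S(3), of "\<theta> powi (- m)"]
    by (simp_all add: mult_ac)
  thus ?thesis using that abs by blast
qed

lemma theta_abs_0: "theta_abs a \<theta> 0 = 0"
  by (simp add: theta_abs_def)

lemma theta_abs_nonneg:
  assumes "x \<in> O\<theta>"
  shows "theta_abs a \<theta> x \<ge> 0"
proof (cases "x = 0")
  case False
  with assms obtain k where "theta_abs a \<theta> x = \<theta> powi k" by (rule theta_abs_conj)
  thus ?thesis using theta_gt_1 by simp
qed (simp add: theta_abs_0)

text \<open>The weak inequalities include x = 0. The comparison of limits and of balls in the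
  completion rests on this pair of bounds.\<close>

lemma theta_abs_bounds:
  assumes "x \<in> O\<theta>"
  shows "\<bar>galois_conj \<theta> x\<bar> \<le> \<theta> * theta_abs a \<theta> x"
    and "theta_abs a \<theta> x \<le> \<theta> * \<bar>galois_conj \<theta> x\<bar>"
proof -
  have "\<bar>galois_conj \<theta> x\<bar> \<le> \<theta> * theta_abs a \<theta> x \<and> theta_abs a \<theta> x \<le> \<theta> * \<bar>galois_conj \<theta> x\<bar>"
  proof (cases "x = 0")
    case False
    with assms obtain k where "theta_abs a \<theta> x = \<theta> powi k"
      "\<theta> powi k / \<theta> < \<bar>galois_conj \<theta> x\<bar>" "\<bar>galois_conj \<theta> x\<bar> < \<theta> * \<theta> powi k"
      by (rule theta_abs_conj)
    thus ?thesis using theta_gt_1 by (simp add: field_simps)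
  qed (simp add: theta_abs_0 galois_conj_0)
  thus "\<bar>galois_conj \<theta> x\<bar> \<le> \<theta> * theta_abs a \<theta> x"
    and "theta_abs a \<theta> x \<le> \<theta> * \<bar>galois_conj \<theta> x\<bar>" by auto
qed

end

section \<open>Limits superior and neighbourhood bases\<close>

text \<open>Some subsequence converges to the limit superior, and a finite set is closed.\<close>

lemma limsup_in_finite:
  fixes u :: "nat \<Rightarrow> ereal"
  assumes "finite W" "eventually (\<lambda>i. u i \<in> W) sequentially"
  shows "limsup u \<in> W"
proof -
  obtain r where r: "strict_mono r" "(u \<circ> r) \<longlonglongrightarrow> limsup u"
    using limsup_subseq_lim by blast
  have "eventually (\<lambda>i. (u \<circ> r) i \<in> W) sequentially"
    using eventually_subseq[OF r(1) assms(2)] by simp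
  thus ?thesis
    using r(2) finite_imp_closed[OF assms(1)]
    by (intro Lim_in_closed_set[of W "u \<circ> r" sequentially]) auto
qed

text \<open>The topology in question is the pullback of the Euclidean one along f. The assumptions
  \<open>inner\<close> and \<open>outer\<close> say that the sets \<open>B x \<epsilon>\<close> and
  the preimages of intervals around \<open>f x\<close> refine each other, so the pullback has the
  required neighbourhoods. It is the only such topology, and a bijection is a homeomorphism from its
  pullback topology.\<close>

lemma homeomorphic_map_of_neighbourhood_base:
  fixes f :: "'a \<Rightarrow> real" and B :: "'a \<Rightarrow> real \<Rightarrow> 'a set"
  assumes bij: "bij_betw f C UNIV"
    and inner: "\<And>x \<epsilon>. x \<in> C \<Longrightarrow> \<epsilon> > 0 \<Longrightarrow> \<exists>\<delta>>0. \<forall>y\<in>C. \<bar>f x - f y\<bar> < \<delta> \<longrightarrow> y \<in> B x \<epsilon>"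
    and outer: "\<And>x \<epsilon>. x \<in> C \<Longrightarrow> \<epsilon> > 0 \<Longrightarrow> \<exists>\<delta>>0. \<forall>y\<in>B x \<delta>. y \<in> C \<and> \<bar>f x - f y\<bar> < \<epsilon>"
  shows "homeomorphic_map
    (THE T. topspace T = C \<and>
      (\<forall>x\<in>C. \<forall>U. (\<exists>V. openin T V \<and> x \<in> V \<and> V \<subseteq> U) \<longleftrightarrow> (\<exists>\<epsilon>>0. B x \<epsilon> \<subseteq> U)))
    euclideanreal f"
proof -
  define nbhd_base where "nbhd_base T \<longleftrightarrow> topspace T = C \<and>
      (\<forall>x\<in>C. \<forall>U. (\<exists>V. openin T V \<and> x \<in> V \<and> V \<subseteq> U) \<longleftrightarrow> (\<exists>\<epsilon>>0. B x \<epsilon> \<subseteq> U))" for T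
  have inj: "inj_on f C" and surj: "f ` C = UNIV" using bij by (auto simp: bij_betw_def)
  let ?T = "pullback_topology C f euclideanreal"
  have top: "topspace ?T = C" by (simp add: topspace_pullback_topology)
  have "(\<exists>V. openin ?T V \<and> x \<in> V \<and> V \<subseteq> U) \<longleftrightarrow> (\<exists>\<epsilon>>0. B x \<epsilon> \<subseteq> U)" if x: "x \<in> C" for x U
  proof
    assume "\<exists>V. openin ?T V \<and> x \<in> V \<and> V \<subseteq> U"
    then obtain W where W: "open W" "f x \<in> W" "f -` W \<inter> C \<subseteq> U"
      by (auto simp: openin_pullback_topology)
    then obtain \<epsilon> where \<epsilon>: "\<epsilon> > 0" "\<And>t. \<bar>f x - t\<bar> < \<epsilon> \<Longrightarrow> t \<in> W"
      unfolding open_dist dist_real_def by (metis abs_minus_commute)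
    from outer[OF x \<epsilon>(1)] obtain \<delta> where \<delta>: "\<delta> > 0" "\<forall>y\<in>B x \<delta>. y \<in> C \<and> \<bar>f x - f y\<bar> < \<epsilon>" by blast
    hence "B x \<delta> \<subseteq> U" using \<epsilon>(2) W(3) by blast
    thus "\<exists>\<epsilon>>0. B x \<epsilon> \<subseteq> U" using \<delta>(1) by blast
  next
    assume "\<exists>\<epsilon>>0. B x \<epsilon> \<subseteq> U"
    then obtain \<epsilon> where \<epsilon>: "\<epsilon> > 0" "B x \<epsilon> \<subseteq> U" by blast
    from inner[OF x \<epsilon>(1)] obtain \<delta> where \<delta>: "\<delta> > 0" "\<forall>y\<in>C. \<bar>f x - f y\<bar> < \<delta> \<longrightarrow> y \<in> B x \<epsilon>" by blast
    show "\<exists>V. openin ?T V \<and> x \<in> V \<and> V \<subseteq> U"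
    proof (intro exI conjI)
      show "openin ?T (f -` ball (f x) \<delta> \<inter> C)"
        unfolding openin_pullback_topology by (metis open_ball open_openin)
      show "x \<in> f -` ball (f x) \<delta> \<inter> C" using x \<delta>(1) by simp
      show "f -` ball (f x) \<delta> \<inter> C \<subseteq> U" using \<delta>(2) \<epsilon>(2) by (auto simp: dist_real_def)
    qed
  qed
  hence base: "nbhd_base ?T" by (simp add: nbhd_base_def top)
  have "(THE T. nbhd_base T) = ?T"
  proof (rule the_equality, rule base)
    fix T assume T: "nbhd_base T"
    have "openin T U \<longleftrightarrow> openin ?T U" for U
    proof (cases "U \<subseteq> C")
      case True
      \<comment> \<open>A set is open if and only if it is a neighbourhood of each of its points,
        and the base condition expresses this through \<open>B\<close> alone. Two topologies
        satisfying it therefore agree.\<close>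
      have "openin S U \<longleftrightarrow> (\<forall>x\<in>U. \<exists>\<epsilon>>0. B x \<epsilon> \<subseteq> U)" if "nbhd_base S" for S
      proof -
        have "(\<exists>V. openin S V \<and> x \<in> V \<and> V \<subseteq> U) \<longleftrightarrow> (\<exists>\<epsilon>>0. B x \<epsilon> \<subseteq> U)" if "x \<in> U" for x
          using \<open>nbhd_base S\<close>[unfolded nbhd_base_def, THEN conjunct2, THEN bspec, THEN spec] that True
          by (simp only: subsetD)
        thus ?thesis unfolding openin_subopen[of S U] by (simp cong: ball_cong)
      qed
      thus ?thesis using T base by blast
    next
      case False
      thus ?thesis using T top openin_subset unfolding nbhd_base_def by metis
    qed
    thus "T = ?T" by (simp add: topology_eq)
  qed
  moreover have "homeomorphic_map ?T euclideanreal f"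
    unfolding homeomorphic_map_def quotient_map_def top
  proof (intro conjI allI impI)
    show "f ` C = topspace euclideanreal" using surj by simp
    fix U :: "real set"
    have "openin ?T {x \<in> C. f x \<in> U} \<longleftrightarrow> (\<exists>W. open W \<and> {x \<in> C. f x \<in> U} = f -` W \<inter> C)"
      by (simp add: openin_pullback_topology)
    also have "\<dots> \<longleftrightarrow> (\<exists>W. open W \<and> U = W)"
    proof -
      \<comment> \<open>As f maps \<open>C\<close> onto the reals, a set of reals is determined by
        its preimage.\<close>
      have "{x \<in> C. f x \<in> U} = f -` W \<inter> C \<longleftrightarrow> U = W" for W
      proof
        assume eq: "{x \<in> C. f x \<in> U} = f -` W \<inter> C"
        show "U = W"
        proof (rule Set.set_eqI)
          fix t
          obtain x where "x \<in> C" "f x = t" using surj by (metis UNIV_I imageE)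
          thus "t \<in> U \<longleftrightarrow> t \<in> W" using eq by blast
        qed
      qed auto
      thus ?thesis by simp
    qed
    finally show "openin ?T {x \<in> C. f x \<in> U} \<longleftrightarrow> openin euclideanreal U" by simp
  qed (rule inj)
  ultimately show ?thesis unfolding nbhd_base_def by simp
qed

section \<open>The completion\<close>

locale maximal_quadratic_unit = quadratic_unit +
  assumes ring_of_integers_eq: "ring_of_integers \<theta> = O\<theta>"
begin

section \<open>Cauchy sequences and the limit of their conjugates\<close>

abbreviation R where "R \<equiv> cauchy_ring a \<theta>"

abbreviation S where "S \<equiv> (ring_of_type_algebra :: real ring)"

text \<open>This is the conjugation map on representatives, before passing to cosets. As
  \<open>lim\<close> is total, the value carries meaning only for sequences whose conjugates
  converge.\<close>

definition conj_lim :: "(nat \<Rightarrow> real) \<Rightarrow> real" where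
  "conj_lim f = lim (\<lambda>i. galois_conj \<theta> (f i))"

text \<open>The comparison of \<open>theta_abs\<close> with the absolute value of the conjugate is
  applied to differences; the factor \<theta> is absorbed by taking e / \<theta>.\<close>

lemma theta_cauchy_iff:
  assumes "\<And>i. f i \<in> O\<theta>"
  shows "theta_cauchy a \<theta> f \<longleftrightarrow> Cauchy (\<lambda>i. galois_conj \<theta> (f i))"
proof -
  have diff: "f m - f n \<in> O\<theta>" for m n by (intro int_adjoin_diff assms)
  have conj: "galois_conj \<theta> (f m - f n) = galois_conj \<theta> (f m) - galois_conj \<theta> (f n)" for m n
    by (intro galois_conj_diff assms)
  show ?thesis
  proof
    assume L: "theta_cauchy a \<theta> f"
    show "Cauchy (\<lambda>i. galois_conj \<theta> (f i))"
      unfolding Cauchy_def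
    proof (intro allI impI)
      fix e :: real assume "e > 0"
      hence "e / \<theta> > 0" using theta_gt_1 by simp
      then obtain N where N: "\<And>m n. m \<ge> N \<Longrightarrow> n \<ge> N \<Longrightarrow> theta_abs a \<theta> (f m - f n) < e / \<theta>"
        using L unfolding theta_cauchy_def by blast
      have "dist (galois_conj \<theta> (f m)) (galois_conj \<theta> (f n)) < e" if "m \<ge> N" "n \<ge> N" for m n
      proof -
        have "dist (galois_conj \<theta> (f m)) (galois_conj \<theta> (f n)) \<le> \<theta> * theta_abs a \<theta> (f m - f n)"
          using theta_abs_bounds(1)[OF diff[of m n]] by (simp only: dist_real_def conj)
        also have "\<dots> < \<theta> * (e / \<theta>)"
          using N[OF that] theta_gt_1 by (intro mult_strict_left_mono) auto
        finally show ?thesis using theta_gt_1 by simp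
      qed
      thus "\<exists>M. \<forall>m\<ge>M. \<forall>n\<ge>M. dist (galois_conj \<theta> (f m)) (galois_conj \<theta> (f n)) < e" by blast
    qed
  next
    assume R: "Cauchy (\<lambda>i. galois_conj \<theta> (f i))"
    show "theta_cauchy a \<theta> f"
      unfolding theta_cauchy_def
    proof (intro allI impI)
      fix e :: real assume "e > 0"
      hence "e / \<theta> > 0" using theta_gt_1 by simp
      then obtain N where
        N: "\<And>m n. m \<ge> N \<Longrightarrow> n \<ge> N \<Longrightarrow> dist (galois_conj \<theta> (f m)) (galois_conj \<theta> (f n)) < e / \<theta>"
        using R unfolding Cauchy_def by blast
      have "theta_abs a \<theta> (f m - f n) < e" if "m \<ge> N" "n \<ge> N" for m n
      proof -
        have "theta_abs a \<theta> (f m - f n) \<le> \<theta> * dist (galois_conj \<theta> (f m)) (galois_conj \<theta> (f n))"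
          using theta_abs_bounds(2)[OF diff[of m n]] by (simp only: dist_real_def conj)
        also have "\<dots> < \<theta> * (e / \<theta>)"
          using N[OF that] theta_gt_1 by (intro mult_strict_left_mono) auto
        finally show ?thesis using theta_gt_1 by simp
      qed
      thus "\<exists>N. \<forall>m\<ge>N. \<forall>n\<ge>N. theta_abs a \<theta> (f m - f n) < e" by blast
    qed
  qed
qed

text \<open>Completeness of the reals turns the Cauchy condition on the conjugates into
  convergence.\<close>

lemma carrier_cauchy_ring:
  "f \<in> carrier R \<longleftrightarrow> (\<forall>i. f i \<in> O\<theta>) \<and> (\<lambda>i. galois_conj \<theta> (f i)) \<longlonglongrightarrow> conj_lim f"
  using theta_cauchy_iff[of f]
  by (auto simp: cauchy_ring_def ring_of_integers_eq Cauchy_convergent_iff convergent_LIMSEQ_iff conj_lim_def)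

lemma carrier_cauchy_ringI:
  assumes "\<And>i. f i \<in> O\<theta>" "(\<lambda>i. galois_conj \<theta> (f i)) \<longlonglongrightarrow> y"
  shows "f \<in> carrier R" and "conj_lim f = y"
proof -
  show "conj_lim f = y" unfolding conj_lim_def using assms(2) by (rule limI)
  with assms show "f \<in> carrier R" by (simp add: carrier_cauchy_ring)
qed

lemma cauchy_ring_simps:
  "x \<otimes>\<^bsub>R\<^esub> y = (\<lambda>i. x i * y i)" "x \<oplus>\<^bsub>R\<^esub> y = (\<lambda>i. x i + y i)"
  "\<one>\<^bsub>R\<^esub> = (\<lambda>i. 1)" "\<zero>\<^bsub>R\<^esub> = (\<lambda>i. 0)"
  by (simp_all add: cauchy_ring_def)

lemma cauchy_ring_closed:
  assumes "x \<in> carrier R" "y \<in> carrier R"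
  shows "(\<lambda>i. x i * y i) \<in> carrier R" "conj_lim (\<lambda>i. x i * y i) = conj_lim x * conj_lim y"
    and "(\<lambda>i. x i + y i) \<in> carrier R" "conj_lim (\<lambda>i. x i + y i) = conj_lim x + conj_lim y"
    and "(\<lambda>i. - x i) \<in> carrier R" "conj_lim (\<lambda>i. - x i) = - conj_lim x"
proof -
  have O: "x i \<in> O\<theta>" "y i \<in> O\<theta>" for i using assms by (auto simp: carrier_cauchy_ring)
  have lim: "(\<lambda>i. galois_conj \<theta> (x i)) \<longlonglongrightarrow> conj_lim x" "(\<lambda>i. galois_conj \<theta> (y i)) \<longlonglongrightarrow> conj_lim y"
    using assms by (auto simp: carrier_cauchy_ring)
  have "(\<lambda>i. galois_conj \<theta> (x i * y i)) \<longlonglongrightarrow> conj_lim x * conj_lim y"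
    unfolding galois_conj_mult[OF O] by (intro tendsto_mult lim)
  from carrier_cauchy_ringI[OF int_adjoin_mult(1)[OF O] this]
  show "(\<lambda>i. x i * y i) \<in> carrier R" "conj_lim (\<lambda>i. x i * y i) = conj_lim x * conj_lim y" .
  have "(\<lambda>i. galois_conj \<theta> (x i + y i)) \<longlonglongrightarrow> conj_lim x + conj_lim y"
    unfolding galois_conj_add[OF O] by (intro tendsto_add lim)
  from carrier_cauchy_ringI[OF int_adjoin_add(1)[OF O] this]
  show "(\<lambda>i. x i + y i) \<in> carrier R" "conj_lim (\<lambda>i. x i + y i) = conj_lim x + conj_lim y" .
  have "(\<lambda>i. galois_conj \<theta> (- x i)) \<longlonglongrightarrow> - conj_lim x"
    unfolding galois_conj_minus[OF O(1)] by (intro tendsto_minus lim)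
  from carrier_cauchy_ringI[OF int_adjoin_minus(1)[OF O(1)] this]
  show "(\<lambda>i. - x i) \<in> carrier R" "conj_lim (\<lambda>i. - x i) = - conj_lim x" .
qed

lemma cauchy_ring_const:
  "(\<lambda>i. of_int k) \<in> carrier R" "conj_lim (\<lambda>i. of_int k) = of_int k"
proof -
  have "(\<lambda>i. galois_conj \<theta> (of_int k)) \<longlonglongrightarrow> of_int k"
    unfolding galois_conj_of_int by (rule tendsto_const)
  from carrier_cauchy_ringI[OF int_adjoin_of_int this]
  show "(\<lambda>i. of_int k) \<in> carrier R" "conj_lim (\<lambda>i. of_int k) = of_int k" .
qed

lemma cring_cauchy_ring: "cring R"
proof (rule cringI)
  have zero: "(\<lambda>i. 0) \<in> carrier R" and one: "(\<lambda>i. 1) \<in> carrier R"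
    using cauchy_ring_const(1)[of 0] cauchy_ring_const(1)[of 1] by simp_all
  show "abelian_group R"
  proof (rule abelian_groupI)
    fix x assume x: "x \<in> carrier R"
    show "\<exists>y\<in>carrier R. y \<oplus>\<^bsub>R\<^esub> x = \<zero>\<^bsub>R\<^esub>"
      by (rule bexI[OF _ cauchy_ring_closed(5)[OF x x]]) (simp add: cauchy_ring_simps)
  qed (simp_all add: cauchy_ring_simps cauchy_ring_closed zero add_ac)
  show "comm_monoid R"
    by (rule comm_monoidI) (simp_all add: cauchy_ring_simps cauchy_ring_closed one mult_ac)
qed (simp add: cauchy_ring_simps algebra_simps)

lemma type_algebra_simps:
  "carrier S = UNIV" "x \<otimes>\<^bsub>S\<^esub> y = x * y" "x \<oplus>\<^bsub>S\<^esub> y = x + y" "\<one>\<^bsub>S\<^esub> = 1" "\<zero>\<^bsub>S\<^esub> = 0"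
  by (simp_all add: ring_of_type_algebra_def)

lemma conj_lim_ring_hom: "ring_hom_ring R S conj_lim"
proof (rule ring_hom_ringI2)
  show "ring R" using cring_cauchy_ring by (rule cring.axioms)
  show "ring S" by (rule ring_from_type_algebra)
  show "conj_lim \<in> ring_hom R S"
    using cauchy_ring_const(2)[of 1]
    by (intro ring_hom_memI) (simp_all add: cauchy_ring_simps type_algebra_simps cauchy_ring_closed)
qed

lemma conj_lim_surj: "conj_lim ` carrier R = UNIV"
proof -
  have "y \<in> conj_lim ` carrier R" for y :: real
  proof -
    \<comment> \<open>The conjugates approximating y are \<lfloor>y \<theta>^i\<rfloor> /
      \<theta>^i, with error at most \<theta>^(-i). The sign (-1)^i in \<open>f\<close> cancels that
      of \<eta>^i.\<close>
    define k where "k i = \<lfloor>y * \<theta> ^ i\<rfloor>" for i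
    define f where "f i = of_int (k i * (- 1) ^ i) * \<theta> powi int i" for i
    have O: "f i \<in> O\<theta>" for i
      unfolding f_def by (intro int_adjoin_mult int_adjoin_of_int int_adjoin_powi)
    have conj: "galois_conj \<theta> (f i) = of_int (k i) / \<theta> ^ i" for i
    proof -
      have "galois_conj \<theta> (f i) = of_int (k i * (- 1) ^ i) * \<eta> powi int i"
        unfolding f_def galois_conj_mult[OF int_adjoin_of_int int_adjoin_powi]
          galois_conj_of_int galois_conj_powi by (rule refl)
      also have "\<eta> powi int i = (- 1) ^ i / \<theta> ^ i"
        unfolding power_int_of_nat by (rule power_divide)
      also have "of_int (k i * (- 1) ^ i) * ((- 1) ^ i / \<theta> ^ i) = of_int (k i) / \<theta> ^ i * ((- 1) ^ i * (- 1) ^ i)"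
        by simp
      also have "(- 1) ^ i * (- 1) ^ i = (1 :: real)" by (simp flip: power_mult_distrib)
      finally show ?thesis by simp
    qed
    have bound: "norm (galois_conj \<theta> (f i) - y) \<le> (1 / \<theta>) ^ i" for i
    proof -
      have "\<bar>of_int (k i) - y * \<theta> ^ i\<bar> \<le> 1" unfolding k_def by linarith
      hence "\<bar>of_int (k i) - y * \<theta> ^ i\<bar> / \<theta> ^ i \<le> 1 / \<theta> ^ i"
        using theta_gt_1 by (intro divide_right_mono) auto
      moreover have "galois_conj \<theta> (f i) - y = (of_int (k i) - y * \<theta> ^ i) / \<theta> ^ i"
        unfolding conj using theta_gt_1 by (simp add: diff_divide_distrib)
      ultimately show ?thesis using theta_gt_1 by (simp add: power_divide)
    qed
    have "(\<lambda>i. (1 / \<theta>) ^ i) \<longlonglongrightarrow> 0" using theta_gt_1 by (intro LIMSEQ_realpow_zero) auto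
    hence "(\<lambda>i. galois_conj \<theta> (f i) - y) \<longlonglongrightarrow> 0"
      by (rule Lim_null_comparison[rotated]) (use bound in simp)
    hence "(\<lambda>i. galois_conj \<theta> (f i)) \<longlonglongrightarrow> y" by (rule LIM_zero_cancel)
    from carrier_cauchy_ringI[OF O this] show ?thesis by blast
  qed
  thus ?thesis by blast
qed

lemma theta_abs_tendsto_0_iff:
  assumes "\<And>i. f i \<in> O\<theta>"
  shows "(\<lambda>i. theta_abs a \<theta> (f i)) \<longlonglongrightarrow> 0 \<longleftrightarrow> (\<lambda>i. galois_conj \<theta> (f i)) \<longlonglongrightarrow> 0"
proof
  assume "(\<lambda>i. theta_abs a \<theta> (f i)) \<longlonglongrightarrow> 0"
  hence "(\<lambda>i. \<theta> * theta_abs a \<theta> (f i)) \<longlonglongrightarrow> 0" by (rule tendsto_mult_right_zero)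
  thus "(\<lambda>i. galois_conj \<theta> (f i)) \<longlonglongrightarrow> 0"
    by (rule Lim_null_comparison[rotated]) (simp add: theta_abs_bounds assms)
next
  assume "(\<lambda>i. galois_conj \<theta> (f i)) \<longlonglongrightarrow> 0"
  hence "(\<lambda>i. \<theta> * \<bar>galois_conj \<theta> (f i)\<bar>) \<longlonglongrightarrow> 0"
    by (intro tendsto_mult_right_zero tendsto_rabs_zero)
  thus "(\<lambda>i. theta_abs a \<theta> (f i)) \<longlonglongrightarrow> 0"
    by (rule Lim_null_comparison[rotated]) (simp add: theta_abs_bounds theta_abs_nonneg assms)
qed

text \<open>This brings the completion into the form of the first isomorphism theorem and shows that
  the null sequences form an ideal.\<close>

lemma null_ideal_eq_kernel: "null_ideal a \<theta> = a_kernel R S conj_lim"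
  unfolding null_ideal_def a_kernel_def'
proof (intro Collect_cong conj_cong refl)
  fix f assume f: "f \<in> carrier R"
  hence "(\<lambda>i. theta_abs a \<theta> (f i)) \<longlonglongrightarrow> 0 \<longleftrightarrow> (\<lambda>i. galois_conj \<theta> (f i)) \<longlonglongrightarrow> 0"
    by (intro theta_abs_tendsto_0_iff) (simp add: carrier_cauchy_ring)
  also have "\<dots> \<longleftrightarrow> conj_lim f = 0"
    using f unfolding carrier_cauchy_ring by (metis LIMSEQ_unique)
  finally show "(\<lambda>i. theta_abs a \<theta> (f i)) \<longlonglongrightarrow> 0 \<longleftrightarrow> conj_lim f = \<zero>\<^bsub>S\<^esub>"
    by (simp add: type_algebra_simps)
qed

section \<open>The quotient ring and its isomorphism with the reals\<close>

abbreviation Q where "Q \<equiv> theta_completion a \<theta>"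

lemma completion_eq: "Q = R Quot a_kernel R S conj_lim"
  by (simp add: theta_completion_def null_ideal_eq_kernel)

text \<open>Two Cauchy sequences differ by an element of the kernel exactly when their conjugates
  have the same limit, so cosets are fibres of \<open>conj_lim\<close>.\<close>

lemma completionE:
  assumes "F \<in> carrier Q"
  obtains y where "F = {f \<in> carrier R. conj_lim f = y}"
proof -
  obtain f where f: "f \<in> carrier R" and F: "F = a_kernel R S conj_lim +>\<^bsub>R\<^esub> f"
    using assms by (auto simp: completion_eq FactRing_def A_RCOSETS_def')
  have "F = {g \<in> carrier R. conj_lim g = conj_lim f}"
  proof (intro equalityI subsetI)
    fix g assume "g \<in> F"
    then obtain k where k: "k \<in> a_kernel R S conj_lim" and g: "g = k \<oplus>\<^bsub>R\<^esub> f"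
      unfolding F a_r_coset_def' by blast
    have "k \<in> carrier R" "conj_lim k = 0" using k by (simp_all add: a_kernel_def' type_algebra_simps)
    thus "g \<in> {g \<in> carrier R. conj_lim g = conj_lim f}"
      using f by (simp add: g cauchy_ring_simps cauchy_ring_closed)
  next
    fix g assume g: "g \<in> {g \<in> carrier R. conj_lim g = conj_lim f}"
    define k where "k = (\<lambda>i. g i + - f i)"
    have "k \<in> carrier R" "conj_lim k = 0"
      using f g cauchy_ring_closed(3,4)[of g "\<lambda>i. - f i"] cauchy_ring_closed(5,6)[of f f]
      by (simp_all add: k_def)
    hence "k \<in> a_kernel R S conj_lim" by (simp add: a_kernel_def' type_algebra_simps)
    moreover have "g = k \<oplus>\<^bsub>R\<^esub> f" by (simp add: k_def cauchy_ring_simps)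
    ultimately show "g \<in> F" by (auto simp: F a_r_coset_def')
  qed
  thus ?thesis by (rule that)
qed

text \<open>Surjectivity of \<open>conj_lim\<close> makes the fibre nonempty; over an empty fibre
  every real would satisfy the description.\<close>

lemma completion_conj_level_set:
  "completion_conj \<theta> {f \<in> carrier R. conj_lim f = y} = y"
proof -
  obtain f where f: "f \<in> carrier R" "conj_lim f = y" using conj_lim_surj by (metis UNIV_I imageE)
  show ?thesis
    unfolding completion_conj_def
  proof (rule the_equality)
    fix z assume "\<forall>x\<in>{f \<in> carrier R. conj_lim f = y}. (\<lambda>i. galois_conj \<theta> (x i)) \<longlonglongrightarrow> z"
    thus "z = y" using f by (metis (mono_tags, lifting) LIMSEQ_unique carrier_cauchy_ring mem_Collect_eq)
  qed (auto simp: carrier_cauchy_ring)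
qed

lemma completion_conj_ring_iso: "completion_conj \<theta> \<in> ring_iso Q S"
proof -
  interpret Q: ring Q unfolding completion_eq
    by (rule ideal.quotient_is_ring[OF ring_hom_ring.kernel_is_ideal[OF conj_lim_ring_hom]])
  have iso: "(\<lambda>F. the_elem (conj_lim ` F)) \<in> ring_iso Q S"
    unfolding completion_eq
    by (rule ring_hom_ring.FactRing_iso_set[OF conj_lim_ring_hom]) (simp add: conj_lim_surj type_algebra_simps)
  \<comment> \<open>The isomorphism theorem supplies a map defined through \<open>the_elem\<close>.
    It agrees with \<open>completion_conj\<close> on the carrier, so the isomorphism properties
    carry over.\<close>
  have eq: "completion_conj \<theta> F = the_elem (conj_lim ` F)" if "F \<in> carrier Q" for F
  proof -
    obtain y where F: "F = {f \<in> carrier R. conj_lim f = y}" using \<open>F \<in> carrier Q\<close> by (rule completionE)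
    obtain f where "f \<in> carrier R" "conj_lim f = y" using conj_lim_surj by (metis UNIV_I imageE)
    hence "conj_lim ` F = {y}" by (auto simp: F)
    thus ?thesis by (simp add: F completion_conj_level_set)
  qed
  show ?thesis
  proof (rule ring_iso_memI)
    fix F G assume FG: "F \<in> carrier Q" "G \<in> carrier Q"
    show "completion_conj \<theta> F \<in> carrier S" by (simp only: type_algebra_simps UNIV_I)
    show "completion_conj \<theta> (F \<otimes>\<^bsub>Q\<^esub> G) = completion_conj \<theta> F \<otimes>\<^bsub>S\<^esub> completion_conj \<theta> G"
      using ring_iso_memE(2)[OF iso FG] by (simp only: eq[OF FG(1)] eq[OF FG(2)] eq[OF Q.m_closed[OF FG]])
    show "completion_conj \<theta> (F \<oplus>\<^bsub>Q\<^esub> G) = completion_conj \<theta> F \<oplus>\<^bsub>S\<^esub> completion_conj \<theta> G"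
      using ring_iso_memE(3)[OF iso FG] by (simp only: eq[OF FG(1)] eq[OF FG(2)] eq[OF Q.a_closed[OF FG]])
  next
    show "completion_conj \<theta> \<one>\<^bsub>Q\<^esub> = \<one>\<^bsub>S\<^esub>"
      using ring_iso_memE(4)[OF iso] by (simp only: eq[OF Q.one_closed])
    show "bij_betw (completion_conj \<theta>) (carrier Q) (carrier S)"
      using ring_iso_memE(5)[OF iso] by (simp only: eq cong: bij_betw_cong)
  qed
qed

text \<open>Each representative of a class with conjugate y has its limit superior between
  \<bar>y\<bar> / \<theta> and \<theta> \<bar>y\<bar>. The same bounds hold for the maximum once it
  is known to be attained.\<close>

lemma completion_conj_abs:
  assumes "F \<in> carrier Q"
  shows "completion_abs a \<theta> F \<le> ereal (\<theta> * \<bar>completion_conj \<theta> F\<bar>)"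
    and "ereal (\<bar>completion_conj \<theta> F\<bar> / \<theta>) \<le> completion_abs a \<theta> F"
proof -
  obtain y where F: "F = {f \<in> carrier R. conj_lim f = y}" using assms by (rule completionE)
  have y: "completion_conj \<theta> F = y" by (simp add: F completion_conj_level_set)
  define L where "L h = limsup (\<lambda>i. ereal (theta_abs a \<theta> (h i)))" for h :: "nat \<Rightarrow> real"
  have bounds: "L h \<le> ereal (\<theta> * \<bar>y\<bar>)" "ereal (\<bar>y\<bar> / \<theta>) \<le> L h" if "h \<in> F" for h
  proof -
    have O: "h i \<in> O\<theta>" for i using that by (simp add: F carrier_cauchy_ring)
    have lim: "(\<lambda>i. galois_conj \<theta> (h i)) \<longlonglongrightarrow> y"
      using that by (auto simp: F carrier_cauchy_ring)
    have "L h \<le> limsup (\<lambda>i. ereal (\<theta> * \<bar>galois_conj \<theta> (h i)\<bar>))"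
      unfolding L_def by (intro Limsup_mono always_eventually) (simp add: theta_abs_bounds O)
    also have "\<dots> = ereal (\<theta> * \<bar>y\<bar>)"
      using lim by (intro lim_imp_Limsup tendsto_ereal tendsto_intros) auto
    finally show "L h \<le> ereal (\<theta> * \<bar>y\<bar>)" .
    have "ereal (\<bar>y\<bar> / \<theta>) = limsup (\<lambda>i. ereal (\<bar>galois_conj \<theta> (h i)\<bar> / \<theta>))"
      using lim theta_gt_1 by (intro lim_imp_Limsup[symmetric] tendsto_ereal tendsto_intros) auto
    also have "\<dots> \<le> L h"
      unfolding L_def
    proof (intro Limsup_mono always_eventually allI)
      fix i
      show "ereal (\<bar>galois_conj \<theta> (h i)\<bar> / \<theta>) \<le> ereal (theta_abs a \<theta> (h i))"
        using theta_abs_bounds(1)[OF O[of i]] theta_gt_1 by (simp add: pos_divide_le_eq mult.commute)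
    qed
    finally show "ereal (\<bar>y\<bar> / \<theta>) \<le> L h" .
  qed
  \<comment> \<open>\<open>GREATEST\<close> needs an attained maximum, which boundedness alone does
    not give. For y = 0 the bounds leave only the value 0; otherwise the values of
    \<open>theta_abs\<close> are eventually powers of \<theta> in a window bounded away from
    0.\<close>
  have fin: "finite (L ` F)"
  proof (cases "y = 0")
    case True
    have "L h = ereal 0" if "h \<in> F" for h
      using bounds[OF that] by (intro antisym) (simp_all only: True abs_zero mult_zero_right div_0)
    hence "L ` F \<subseteq> {ereal 0}" by blast
    thus ?thesis by (rule finite_subset) simp
  next
    case False
    \<comment> \<open>The conjugates eventually lie between \<bar>y\<bar> / 2 and 2 \<bar>y\<bar>;
      passing to \<open>theta_abs\<close> costs another factor \<theta> on either side.\<close>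
    define c d where "c = \<bar>y\<bar> / 2 / \<theta>" and "d = \<theta> * (2 * \<bar>y\<bar>)"
    define W where "W = (\<lambda>k. ereal (\<theta> powi k)) ` {k::int. c \<le> \<theta> powi k \<and> \<theta> powi k \<le> d}"
    have "c > 0" using False theta_gt_1 by (simp add: c_def)
    hence "finite W" unfolding W_def by (intro finite_imageI finite_powi_between)
    have "L h \<in> W" if "h \<in> F" for h
      unfolding L_def
    proof (rule limsup_in_finite[OF \<open>finite W\<close>])
      have O: "h i \<in> O\<theta>" for i using that by (simp add: F carrier_cauchy_ring)
      have lim: "(\<lambda>i. galois_conj \<theta> (h i)) \<longlonglongrightarrow> y"
        using that by (auto simp: F carrier_cauchy_ring)
      have abs_lim: "(\<lambda>i. \<bar>galois_conj \<theta> (h i)\<bar>) \<longlonglongrightarrow> \<bar>y\<bar>" using lim by (rule tendsto_rabs)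
      have "\<forall>\<^sub>F i in sequentially. \<bar>y\<bar> / 2 < \<bar>galois_conj \<theta> (h i)\<bar>"
        and "\<forall>\<^sub>F i in sequentially. \<bar>galois_conj \<theta> (h i)\<bar> < 2 * \<bar>y\<bar>"
        by (rule order_tendstoD[OF abs_lim]; use False in simp)+
      thus "\<forall>\<^sub>F i in sequentially. ereal (theta_abs a \<theta> (h i)) \<in> W"
      proof eventually_elim
        case (elim i)
        have "h i \<noteq> 0" using elim(1) False by (auto simp: galois_conj_0)
        with O[of i] obtain k where k: "theta_abs a \<theta> (h i) = \<theta> powi k" by (rule theta_abs_conj)
        have "c \<le> \<bar>galois_conj \<theta> (h i)\<bar> / \<theta>"
          unfolding c_def using elim(1) theta_gt_1 by (intro divide_right_mono) auto
        also have "\<dots> \<le> \<theta> powi k"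
          using theta_abs_bounds(1)[OF O[of i]] theta_gt_1 by (simp add: k pos_divide_le_eq mult.commute)
        finally have "c \<le> \<theta> powi k" .
        moreover have "\<theta> powi k \<le> \<theta> * \<bar>galois_conj \<theta> (h i)\<bar>"
          using theta_abs_bounds(2)[OF O[of i]] by (simp only: k)
        hence "\<theta> powi k \<le> d"
          unfolding d_def by (rule order_trans) (use elim(2) theta_gt_1 in \<open>intro mult_left_mono; simp\<close>)
        ultimately show ?case unfolding W_def k by blast
      qed
    qed
    hence "L ` F \<subseteq> W" by blast
    thus ?thesis using \<open>finite W\<close> by (rule finite_subset)
  qed
  obtain f where "f \<in> carrier R" "conj_lim f = y" using conj_lim_surj by (metis UNIV_I imageE)
  hence "L ` F \<noteq> {}" by (auto simp: F)
  have "completion_abs a \<theta> F = Max (L ` F)"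
    unfolding completion_abs_def L_def[symmetric]
  proof (rule Greatest_equality)
    show "\<exists>h\<in>F. Max (L ` F) = L h" using Max_in[OF fin \<open>L ` F \<noteq> {}\<close>] by blast
    show "v \<le> Max (L ` F)" if "\<exists>h\<in>F. v = L h" for v using that fin by auto
  qed
  then obtain h where "h \<in> F" "completion_abs a \<theta> F = L h"
    using Max_in[OF fin \<open>L ` F \<noteq> {}\<close>] by auto
  thus "completion_abs a \<theta> F \<le> ereal (\<theta> * \<bar>completion_conj \<theta> F\<bar>)"
    and "ereal (\<bar>completion_conj \<theta> F\<bar> / \<theta>) \<le> completion_abs a \<theta> F"
    using bounds y by simp_all
qed

section \<open>Field structure and topology of the completion\<close>

lemma ring_completion: "ring Q"
  unfolding completion_eq by (rule ideal.quotient_is_ring[OF ring_hom_ring.kernel_is_ideal[OF conj_lim_ring_hom]])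

lemma field_completion: "field Q"
proof -
  let ?g = "inv_into (carrier Q) (completion_conj \<theta>)"
  interpret S: field S by (rule field_from_type_algebra)
  have g: "?g \<in> ring_iso S Q"
    by (rule ring_iso_set_sym[OF ring_completion completion_conj_ring_iso])
  hence "field (Q\<lparr>zero := ?g \<zero>\<^bsub>S\<^esub>\<rparr>)" by (rule S.ring_iso_imp_img_field)
  \<comment> \<open>The transported field has its zero replaced by the image of the real zero; as
    \<open>?g\<close> preserves zero, this update leaves the ring as it is.\<close>
  moreover have "?g \<zero>\<^bsub>S\<^esub> = \<zero>\<^bsub>Q\<^esub>"
    using g S.ring_axioms ring_completion by (intro ring_hom_zero) (auto simp: ring_iso_def)
  ultimately show ?thesis by simp
qed

lemma completion_conj_diff:
  assumes "F \<in> carrier Q" "G \<in> carrier Q"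
  shows "completion_conj \<theta> (F \<ominus>\<^bsub>Q\<^esub> G) = completion_conj \<theta> F - completion_conj \<theta> G"
proof -
  interpret Q: ring Q by (rule ring_completion)
  have hom: "completion_conj \<theta> \<in> ring_hom Q S"
    using completion_conj_ring_iso by (simp add: ring_iso_def)
  have "completion_conj \<theta> F = completion_conj \<theta> ((F \<ominus>\<^bsub>Q\<^esub> G) \<oplus>\<^bsub>Q\<^esub> G)"
    using assms by (simp add: a_minus_def Q.a_assoc Q.l_neg)
  also have "\<dots> = completion_conj \<theta> (F \<ominus>\<^bsub>Q\<^esub> G) + completion_conj \<theta> G"
    using ring_hom_add[OF hom, of "F \<ominus>\<^bsub>Q\<^esub> G" G] assms by (simp add: type_algebra_simps)
  finally show ?thesis by simp
qed

text \<open>Balls and preimages of intervals refine each other with \<delta> = \<epsilon> / \<theta>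
  in both directions, since \<open>completion_conj_abs\<close> loses a factor \<theta> each
  way.\<close>

lemma completion_conj_homeomorphic:
  "homeomorphic_map (inframetric_topology a \<theta>) euclideanreal (completion_conj \<theta>)"
  unfolding inframetric_topology_def
proof (rule homeomorphic_map_of_neighbourhood_base)
  interpret Q: ring Q by (rule ring_completion)
  show "bij_betw (completion_conj \<theta>) (carrier Q) UNIV"
    using completion_conj_ring_iso by (simp add: ring_iso_def type_algebra_simps)
  fix F and \<epsilon> :: real
  assume F: "F \<in> carrier Q" and "\<epsilon> > 0"
  show "\<exists>\<delta>>0. \<forall>G\<in>carrier Q. \<bar>completion_conj \<theta> F - completion_conj \<theta> G\<bar> < \<delta> \<longrightarrow>
      G \<in> inframetric_ball a \<theta> F \<epsilon>"
  proof (intro exI conjI ballI impI)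
    show "\<epsilon> / \<theta> > 0" using \<open>\<epsilon> > 0\<close> theta_gt_1 by simp
    fix G assume G: "G \<in> carrier Q" and lt: "\<bar>completion_conj \<theta> F - completion_conj \<theta> G\<bar> < \<epsilon> / \<theta>"
    have "\<theta> * \<bar>completion_conj \<theta> F - completion_conj \<theta> G\<bar> < \<epsilon>"
      using lt theta_gt_1 by (simp add: pos_less_divide_eq mult.commute)
    hence "completion_abs a \<theta> (F \<ominus>\<^bsub>Q\<^esub> G) < ereal \<epsilon>"
      using completion_conj_abs(1)[OF Q.minus_closed[OF F G]] completion_conj_diff[OF F G]
      by (metis ereal_less(2) less_ereal.simps(1) order_le_less_trans)
    thus "G \<in> inframetric_ball a \<theta> F \<epsilon>" using G by (simp add: inframetric_ball_def)
  qed
  show "\<exists>\<delta>>0. \<forall>G\<in>inframetric_ball a \<theta> F \<delta>.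
      G \<in> carrier Q \<and> \<bar>completion_conj \<theta> F - completion_conj \<theta> G\<bar> < \<epsilon>"
  proof (intro exI conjI ballI)
    show "\<epsilon> / \<theta> > 0" using \<open>\<epsilon> > 0\<close> theta_gt_1 by simp
    fix G assume "G \<in> inframetric_ball a \<theta> F (\<epsilon> / \<theta>)"
    hence G: "G \<in> carrier Q" and lt: "completion_abs a \<theta> (F \<ominus>\<^bsub>Q\<^esub> G) < ereal (\<epsilon> / \<theta>)"
      by (auto simp: inframetric_ball_def)
    show "G \<in> carrier Q" by (rule G)
    have "ereal (\<bar>completion_conj \<theta> F - completion_conj \<theta> G\<bar> / \<theta>) < ereal (\<epsilon> / \<theta>)"
      using completion_conj_abs(2)[OF Q.minus_closed[OF F G]] completion_conj_diff[OF F G] lt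
      by (metis order_le_less_trans)
    thus "\<bar>completion_conj \<theta> F - completion_conj \<theta> G\<bar> < \<epsilon>"
      using theta_gt_1 by (simp add: divide_less_cancel)
  qed
qed

end

theorem theorem30:
  fixes a :: int and \<theta> :: real
  assumes "a \<ge> 1" and "\<theta> > 1" and "\<theta>\<^sup>2 = of_int a * \<theta> + 1"
    and "ring_of_integers \<theta> = int_adjoin \<theta>"
  shows "field (theta_completion a \<theta>) \<and>
    completion_conj \<theta> \<in> ring_iso (theta_completion a \<theta>) (ring_of_type_algebra :: real ring) \<and>
    homeomorphic_map (inframetric_topology a \<theta>) euclideanreal (completion_conj \<theta>)"
proof -
  interpret maximal_quadratic_unit a \<theta> using assms by unfold_locales
  show ?thesis
    using field_completion completion_conj_ring_iso completion_conj_homeomorphic by blast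
qed

end
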